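(* The map $\mathrm{fRSK}:\mathcal L_n\to\mathcal{FP}_n$ is a bijection. Moreover, if $L\in\mathcal L_n$ and $(S,T)=\mathrm{fRSK}(L)$, then $\mathrm{col}(L)=\mathrm{wt}(S)$ and $\mathrm{row}(L)=\mathrm{wt}(T)$.
   Context: Fix $n\ge1$, $[n]=\{1,\dots,n\}$. $\mathcal L_n$ is the set of lower triangular $n\times n$ matrices with entries in $\mathbb N$; $\mathrm{row}(L)$ and $\mathrm{col}(L)$ are the weak compositions of row sums and column sums. $L$ corresponds to the biword (multiset with $L_{ij}$ copies of $\binom ij$), written $\binom{i_1\,\cdots\,i_\ell}{j_1\,\cdots\,j_\ell}$ with $i_k\le i_{k+1}$ and $j_k\ge j_{k+1}$ whenever $i_k=i_{k+1}$; here $j_k\le i_k$. Cells $(c,r)$: column $c$, row $r$, row 1 at the bottom. Key diagrams $\mathbb D(\mathbf a)=\{(c,r):1\le c\le\mathbf a_r\}$ for $\mathbf a\in\mathbb N^n$; a filling $T:\mathbb D(\mathbf a)\to[n]$ has shape $\mathrm{sh}(T)=\mathbf a$ and weight $\mathrm{wt}(T)_i=|T^{-1}(i)|$; $\hat T$ adds basement cells $(0,r)$ with $\hat T(0,r)=r$, $r\in[n]$. Cells attack if in the same column or in adjacent columns with the left one strictly higher. Triples: three cells of $\hat T$ with distinct entries of the form $(c,r),(c+1,r),(c,s)$, $r<s$, $\mathbf a_r>\mathbf a_s$, or $(c+1,r),(c,s),(c+1,s)$, $r<s$, $\mathbf a_r\le\mathbf a_s$ ($c\ge0$); with $k,i$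 the left and right entries in the common row and $j$ the third entry, it is a co-inversion triple if $i<j<k$, $j<k<i$ or $k<i<j$ and an inversion triple if $i>j>k$, $j>k>i$ or $k>i>j$. $\mathrm{SSKT}_n$: fillings with $\hat T$ non-attacking, rows of $\hat T$ weakly decreasing left to right, no co-inversion triples. $\mathrm{rSSAF}_n$: $\hat T$ non-attacking, rows of $\hat T$ weakly increasing left to right, no inversion triples. For $i\le n$, $\mathrm{SSKT}_i\subseteq\mathrm{SSKT}_n$ by appending zero parts. $\mathcal{FP}_n=\{(S,T)\in\mathrm{SSKT}_n\times\mathrm{rSSAF}_n:\mathrm{sh}(S)=\mathrm{sh}(T)\}$. Flagged insertion $S\leftharpoondown_i j$ for $S\in\mathrm{SSKT}_i$, $j\in[i]$ (with the $i$ basement cells $(0,1),\dots,(0,i)$ always taken into account): (1) set $c=\infty$; (2) let $c'\le c$ be the largest column index $\ge1$ such that column $c'$ contains strictly fewer entries weakly greater than $j$ than column $c'-1$; (3) among positions $(c',r)$ such that $(c'-1,r)$ holds an entry weakly greater than $j$ and $(c',r)$ is empty or holds an entry strictly smaller than $j$, take the topmost, place $j$ there and remove its previous entry $j'$ if any; (4) if $j'$ was removed, return to (2) with $c:=c'$, $j:=j'$. For $\binom ij$ with $j\le i$, $(S,T)\leftharpoondown\binom ij=(S\leftharpoondown_ij,T')$ where $T'$ is $T$ with the cell $\mathbb D(\mathrm{sh}(S\leftharpoondown_ij))\setminus\mathbb D(\mathrm{sh}(S))$ added with entry $i$. $\mathrm{fRSK}(L)$ is obtained by successively applying $\leftharpoondown\binom{i_1}{j_1},\dots,\leftharpoondown\binom{i_\ell}{j_\ell}$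 to $(\emptyset,\emptyset)$. *)

theory Defs
  imports Main "HOL-Library.Extended_Nat"
begin

section \<open>Lower triangular matrices and biwords\<close>

text \<open>An \<open>n \<times> n\<close> matrix over the naturals is a function of the indices \<open>1, \<dots>, n\<close>, extended by
  zero, so that equality of matrices is equality of functions. Weak compositions of length \<open>n\<close>
  are encoded in the same way.\<close>

definition lower_triangular :: "nat \<Rightarrow> (nat \<Rightarrow> nat \<Rightarrow> nat) set" where
  "lower_triangular n = {L. \<forall>i j. L i j \<noteq> 0 \<longrightarrow> 1 \<le> j \<and> j \<le> i \<and> i \<le> n}"

definition weak_compositions :: "nat \<Rightarrow> (nat \<Rightarrow> nat) set" where
  "weak_compositions n = {a. \<forall>r. r \<notin> {1..n} \<longrightarrow> a r = 0}"

definition row :: "nat \<Rightarrow> (nat \<Rightarrow> nat \<Rightarrow> nat) \<Rightarrow> nat \<Rightarrow> nat" where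
  "row n L = (\<lambda>i. \<Sum>j\<in>{1..n}. L i j)"

definition col :: "nat \<Rightarrow> (nat \<Rightarrow> nat \<Rightarrow> nat) \<Rightarrow> nat \<Rightarrow> nat" where
  "col n L = (\<lambda>j. \<Sum>i\<in>{1..n}. L i j)"

definition biword :: "nat \<Rightarrow> (nat \<Rightarrow> nat \<Rightarrow> nat) \<Rightarrow> (nat \<times> nat) list" where
  "biword n L =
     concat (map (\<lambda>i. concat (map (\<lambda>j. replicate (L i j) (i, j)) (rev [1..<Suc n]))) [1..<Suc n])"

lemma count_list_biword:
  assumes "L \<in> lower_triangular n"
  shows "count_list (biword n L) (i, j) = L i j"
proof -
  have rep: "count_list (replicate m x) y = (if x = y then m else 0)" for m and x y :: "nat \<times> nat"
    by (induction m) auto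
  have cc: "count_list (concat (map f xs)) y = (\<Sum>x\<leftarrow>xs. count_list (f x) y)"
    for f :: "nat \<Rightarrow> (nat \<times> nat) list" and xs y
    by (induction xs) auto
  have "count_list (biword n L) (i, j) =
      (\<Sum>i'\<in>{1..n}. \<Sum>j'\<in>{1..n}. if i' = i \<and> j' = j then L i' j' else 0)"
    by (simp add: biword_def cc rep sum_list_distinct_conv_sum_set atLeastLessThanSuc_atLeastAtMost
        del: upt_Suc)
  also have "\<dots> = (\<Sum>i'\<in>{1..n}. if i' = i then (\<Sum>j'\<in>{1..n}. if j' = j then L i j' else 0) else 0)"
    by (intro sum.cong) auto
  also have "\<dots> = L i j"
    using assms by (force simp: lower_triangular_def)
  finally show ?thesis .
qed

lemma sorted_wrt_biword:
  "sorted_wrt (\<lambda>(i, j) (i', j'). i < i' \<or> i = i' \<and> j \<ge> j') (biword n L)"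
proof -
  have concat: "sorted_wrt P (concat (map f xs))"
    if "\<And>x. x \<in> set xs \<Longrightarrow> sorted_wrt P (f x)"
      and "sorted_wrt (\<lambda>x y. \<forall>u\<in>set (f x). \<forall>v\<in>set (f y). P u v) xs"
    for P :: "nat \<times> nat \<Rightarrow> nat \<times> nat \<Rightarrow> bool" and f and xs :: "nat list"
    using that by (induction xs) (auto simp: sorted_wrt_append)
  have rep: "sorted_wrt P (replicate m x)" if "P x x" for P m and x :: "nat \<times> nat"
    using that by (induction m) auto
  have up: "sorted_wrt (<) [1..<Suc n]"
    by (rule sorted_wrt_upt)
  then have down: "sorted_wrt (>) (rev [1..<Suc n])"
    by (simp add: sorted_wrt_rev del: upt_Suc)
  show ?thesis
    unfolding biword_def
    by (intro concat rep sorted_wrt_mono_rel[OF _ up] sorted_wrt_mono_rel[OF _ down])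
      (auto simp del: upt_Suc)
qed


section \<open>Key diagrams and fillings\<close>

text \<open>A cell is a pair \<open>(c, r)\<close> of a column and a row, and a filling is a partial map on cells,
  so that appending zero parts to the shape does not change the filling.\<close>

type_synonym cell = "nat \<times> nat"
type_synonym filling = "cell \<rightharpoonup> nat"

definition key_diagram :: "(nat \<Rightarrow> nat) \<Rightarrow> cell set" where
  "key_diagram a = {(c, r). 1 \<le> c \<and> c \<le> a r}"

definition fillings :: "nat \<Rightarrow> filling set" where
  "fillings n = {T. (\<exists>a\<in>weak_compositions n. dom T = key_diagram a) \<and> ran T \<subseteq> {1..n}}"

definition sh :: "filling \<Rightarrow> nat \<Rightarrow> nat" where
  "sh T = (\<lambda>r. card {c. (c, r) \<in> dom T})"

definition wt :: "filling \<Rightarrow> nat \<Rightarrow> nat" where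
  "wt T = (\<lambda>i. card {x. T x = Some i})"

lemma sh_eq_if_dom_eq_key_diagram:
  assumes "dom T = key_diagram a"
  shows "sh T = a"
proof
  fix r
  have "{c. (c, r) \<in> dom T} = {1..a r}"
    using assms by (auto simp: key_diagram_def)
  then show "sh T r = a r"
    by (simp add: sh_def)
qed

text \<open>The filling \<open>T\<close> together with the basement cells \<open>(0, r)\<close>, \<open>1 \<le> r \<le> n\<close>.\<close>

definition hat :: "nat \<Rightarrow> filling \<Rightarrow> filling" where
  "hat n T = (\<lambda>(c, r). if c = 0 then (if r \<in> {1..n} then Some r else None) else T (c, r))"

fun attack :: "cell \<Rightarrow> cell \<Rightarrow> bool" where
  "attack (c, r) (c', r') \<longleftrightarrow>
     (c = c' \<and> r \<noteq> r') \<or> (c' = c + 1 \<and> r > r') \<or> (c = c' + 1 \<and> r' > r)"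

definition non_attacking :: "filling \<Rightarrow> bool" where
  "non_attacking F \<longleftrightarrow> (\<forall>x\<in>dom F. \<forall>y\<in>dom F. attack x y \<longrightarrow> F x \<noteq> F y)"

definition rows_decreasing :: "filling \<Rightarrow> bool" where
  "rows_decreasing F \<longleftrightarrow>
     (\<forall>c r u v. F (c, r) = Some u \<and> F (c + 1, r) = Some v \<longrightarrow> u \<ge> v)"

definition rows_increasing :: "filling \<Rightarrow> bool" where
  "rows_increasing F \<longleftrightarrow>
     (\<forall>c r u v. F (c, r) = Some u \<and> F (c + 1, r) = Some v \<longrightarrow> u \<le> v)"

text \<open>\<open>triple n T k i j\<close>: the filling with basement has a triple with distinct entries in which
  \<open>k\<close> and \<open>i\<close> are the left and right entries in the common row and \<open>j\<close> is the third entry.\<close>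

definition triple :: "nat \<Rightarrow> filling \<Rightarrow> nat \<Rightarrow> nat \<Rightarrow> nat \<Rightarrow> bool" where
  "triple n T k i j \<longleftrightarrow> distinct [k, i, j] \<and>
     (\<exists>c r s. r < s \<and>
        (sh T r > sh T s \<and>
           hat n T (c, r) = Some k \<and> hat n T (c + 1, r) = Some i \<and> hat n T (c, s) = Some j \<or>
         sh T r \<le> sh T s \<and>
           hat n T (c + 1, r) = Some j \<and> hat n T (c, s) = Some k \<and> hat n T (c + 1, s) = Some i))"

definition coinversion_triple :: "nat \<Rightarrow> filling \<Rightarrow> nat \<Rightarrow> nat \<Rightarrow> nat \<Rightarrow> bool" where
  "coinversion_triple n T k i j \<longleftrightarrow>
     triple n T k i j \<and> (i < j \<and> j < k \<or> j < k \<and> k < i \<or> k < i \<and> i < j)"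

definition inversion_triple :: "nat \<Rightarrow> filling \<Rightarrow> nat \<Rightarrow> nat \<Rightarrow> nat \<Rightarrow> bool" where
  "inversion_triple n T k i j \<longleftrightarrow>
     triple n T k i j \<and> (i > j \<and> j > k \<or> j > k \<and> k > i \<or> k > i \<and> i > j)"

definition SSKT :: "nat \<Rightarrow> filling set" where
  "SSKT n = {T \<in> fillings n. non_attacking (hat n T) \<and> rows_decreasing (hat n T) \<and>
     (\<nexists>k i j. coinversion_triple n T k i j)}"

definition rSSAF :: "nat \<Rightarrow> filling set" where
  "rSSAF n = {T \<in> fillings n. non_attacking (hat n T) \<and> rows_increasing (hat n T) \<and>
     (\<nexists>k i j. inversion_triple n T k i j)}"

definition FP :: "nat \<Rightarrow> (filling \<times> filling) set" where
  "FP n = {(S, T). S \<in> SSKT n \<and> T \<in> rSSAF n \<and> sh S = sh T}"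


section \<open>Flagged insertion\<close>

definition count_ge :: "filling \<Rightarrow> nat \<Rightarrow> nat \<Rightarrow> nat" where
  "count_ge F j c = card {r. \<exists>v. F (c, r) = Some v \<and> v \<ge> j}"

definition insertion_column :: "nat \<Rightarrow> filling \<Rightarrow> enat \<Rightarrow> nat \<Rightarrow> nat" where
  "insertion_column i S c j =
     Max {c'. 1 \<le> c' \<and> enat c' \<le> c \<and> count_ge (hat i S) j c' < count_ge (hat i S) j (c' - 1)}"

definition insertion_rows :: "nat \<Rightarrow> filling \<Rightarrow> nat \<Rightarrow> nat \<Rightarrow> nat set" where
  "insertion_rows i S c' j = {r \<in> {1..i}.
     (\<exists>v. hat i S (c' - 1, r) = Some v \<and> v \<ge> j) \<and>
     (\<forall>v. hat i S (c', r) = Some v \<longrightarrow> v < j)}"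

text \<open>The loop of the insertion algorithm, with current column bound \<open>c\<close> and current entry \<open>j\<close>.
  The branch for an empty set of positions only makes the function total on arbitrary arguments;
  it is not meant to be reached when inserting \<open>j \<in> {1..i}\<close> into an element of \<open>SSKT i\<close>.\<close>

function flagged_insert_loop :: "nat \<Rightarrow> enat \<Rightarrow> filling \<Rightarrow> nat \<Rightarrow> filling" where
  "flagged_insert_loop i c S j =
     (let c' = insertion_column i S c j; R = insertion_rows i S c' j; r = Max R in
      if R = {} then S
      else case S (c', r) of
             None \<Rightarrow> S((c', r) \<mapsto> j)
           | Some j' \<Rightarrow> flagged_insert_loop i (enat c') (S((c', r) \<mapsto> j)) j')"
  by pat_completeness auto
termination
proof (relation "measure (\<lambda>(i, c, S, j). j)")
  fix i c S j c' R r j'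
  assume c': "c' = insertion_column i S c j"
    and R: "R = insertion_rows i S c' j" and r: "r = Max R"
    and ne: "R \<noteq> {}" and j': "S (c', r) = Some j'"
  have "finite R"
    by (auto simp: R insertion_rows_def)
  then have mem: "r \<in> insertion_rows i S c' j"
    using ne R r Max_in by blast
  then have "c' \<noteq> 0"
    by (cases "c' = 0") (auto simp: insertion_rows_def hat_def)
  with mem j' have "j' < j"
    by (simp add: insertion_rows_def hat_def)
  then show "((i, enat c', S((c', r) \<mapsto> j), j'), (i, c, S, j)) \<in> measure (\<lambda>(i, c, S, j). j)"
    by simp
qed simp

declare flagged_insert_loop.simps [simp del]

definition flagged_insert :: "nat \<Rightarrow> filling \<Rightarrow> nat \<Rightarrow> filling" where
  "flagged_insert i S j = flagged_insert_loop i \<infinity> S j"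

definition pair_insert :: "nat \<times> nat \<Rightarrow> filling \<times> filling \<Rightarrow> filling \<times> filling" where
  "pair_insert = (\<lambda>(i, j) (S, T).
     let S' = flagged_insert i S j in
     (S', \<lambda>x. if x \<in> key_diagram (sh S') - key_diagram (sh S) then Some i else T x))"

definition fRSK :: "nat \<Rightarrow> (nat \<Rightarrow> nat \<Rightarrow> nat) \<Rightarrow> filling \<times> filling" where
  "fRSK n L = fold pair_insert (biword n L) (Map.empty, Map.empty)"

end

theory Submission
  imports Defs
begin

text \<open>
  Every bump of the flagged insertion replaces one entry of a filling by another one without
  changing the shape, and a single local criterion (\<open>fits\<close> below) decides whether such a
  replacement stays within the semistandard key tableaux. The criterion passes from the inserted
  entry to the removed one, so it propagates along the bumping route; and as it does not mention
  which of the two entries is larger, it propagates along the reverse route as well. The route adds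
  a cell at the topmost row of its length. Adding a cell with a new maximal entry there is also
  exactly what the conditions on the recording filling allow.

  On the level of column sets, the route visits the columns from right to left with entries that
  weakly decrease. Comparing the routes of two successive insertions shows that the new
  cells of letters with equal upper entry move strictly to the right, and that the last letter of a
  word can be recovered from the column sets together with the position of the last new cell.
\<close>

section \<open>Local moves on key tableaux\<close>

text \<open>Lengthening a row from \<open>c\<close> to \<open>c + 1\<close> changes which of the two
  triple conditions governs it against other rows. If no higher row has length \<open>c\<close>, the
  only affected pairs are those with a lower row of length \<open>c + 1\<close>. This is why the
  topmost row of its length is the place where a cell can be added or removed under control, in both
  fillings. The two halves of bijectivity use different information. For surjectivity a reverse
  route only has to exist; it is never shown to undo a given insertion. For injectivity the rows
  chosen along a route would be hard to follow, as they depend on the whole shape. Column counts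
  forget the rows, and on them the route can be read off from left to right. Equality of the last
  letters then follows before the smaller key tableaux are known to agree. Two successive routes are
  compared in both directions: a weakly smaller second letter keeps the recording filling valid,
  while a larger one is excluded when the rightmost maximal entry is removed, so that the recovered
  word is sorted.\<close>

text \<open>Empty cells have entry \<open>0\<close>, so that ``empty or smaller than \<open>j\<close>'' becomes an inequality.\<close>

definition entry :: "nat \<Rightarrow> filling \<Rightarrow> nat \<Rightarrow> nat \<Rightarrow> nat" where
  "entry i S c r = (case hat i S (c, r) of None \<Rightarrow> 0 | Some x \<Rightarrow> x)"

text \<open>The non-attacking condition for adjacent columns is absorbed into the two triple conditions by making
  one inequality in each of them weak. The shape \<open>a\<close> cannot be localised to two adjacent columns: which
  triple condition applies to two rows depends on their full lengths.\<close>

locale key_filling =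
  fixes i :: nat and a :: "nat \<Rightarrow> nat" and v :: "nat \<Rightarrow> nat \<Rightarrow> nat"
  assumes supp: "r \<notin> {1..i} \<Longrightarrow> a r = 0"
    and pos: "0 < v c r \<longleftrightarrow> r \<in> {1..i} \<and> c \<le> a r"
    and base: "r \<in> {1..i} \<Longrightarrow> v 0 r = r"
    and dec: "v (Suc c) r \<le> v c r"
    and inj: "v c r = v c s \<Longrightarrow> 0 < v c r \<Longrightarrow> r = s"
    and tripA: "r < s \<Longrightarrow> a s < a r \<Longrightarrow> 0 < v c s \<Longrightarrow> v (Suc c) r \<le> v c s \<Longrightarrow> v c r \<le> v c s"
    and tripB: "r < s \<Longrightarrow> a r \<le> a s \<Longrightarrow> 0 < v (Suc c) r \<Longrightarrow> v (Suc c) r \<le> v c s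
      \<Longrightarrow> v (Suc c) r \<le> v (Suc c) s"

text \<open>\<open>fits v c r j\<close> is a criterion for placing \<open>j\<close> in row \<open>r\<close> of column \<open>c + 1\<close>. The first part says that \<open>r\<close> is
  the topmost candidate for a bump from the right; the second part says that \<open>r\<close> is the lowest candidate
  for the reverse bump.\<close>

definition fits :: "(nat \<Rightarrow> nat \<Rightarrow> nat) \<Rightarrow> nat \<Rightarrow> nat \<Rightarrow> nat \<Rightarrow> bool" where
  "fits v c r j \<longleftrightarrow>
     (\<forall>q>r. j \<le> v c q \<longrightarrow> j \<le> v (Suc c) q) \<and>
     (\<forall>q<r. j < v (Suc c) q \<longrightarrow> j < v (Suc (Suc c)) q)"

definition put :: "(nat \<Rightarrow> nat \<Rightarrow> nat) \<Rightarrow> nat \<Rightarrow> nat \<Rightarrow> nat \<Rightarrow> nat \<Rightarrow> nat \<Rightarrow> nat" where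
  "put v c r j = v(c := (v c)(r := j))"

lemma put_apply: "put v c r j d q = (if d = c \<and> q = r then j else v d q)"
  by (simp add: put_def)

context key_filling
begin

lemma dec_le: "c \<le> d \<Longrightarrow> v d r \<le> v c r"
  by (induction d rule: dec_induct) (auto intro: order_trans[OF dec])

lemma le_i: "v c r \<le> i"
proof (cases "r \<in> {1..i}")
  case True then show ?thesis using base[OF True] dec_le[of 0 c r] by auto
next
  case False then have "\<not> 0 < v c r" using pos by blast
  then show ?thesis by simp
qed

text \<open>The order of the basement entries is carried from column to column: \<open>tripB\<close>
  prevents the lower, weakly shorter row from overtaking, and \<open>inj\<close> keeps the
  inequality strict.\<close>

lemma below_increasing:
  assumes "r < s" "a r \<le> a s" "r \<in> {1..i}" "s \<in> {1..i}" "c \<le> a r"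
  shows "v c r < v c s"
  using assms(5)
proof (induction c)
  case 0 then show ?case using base assms by auto
next
  case (Suc c)
  then have "v c r < v c s" by simp
  moreover have p: "0 < v (Suc c) r" using pos Suc.prems assms by auto
  ultimately have "v (Suc c) r \<le> v (Suc c) s"
    using tripB[OF assms(1,2) p] dec[of c r] by linarith
  moreover have "v (Suc c) r \<noteq> v (Suc c) s" using inj[OF _ p] assms(1) by auto
  ultimately show ?case by simp
qed

text \<open>For one kind of row pair the triple condition settles the claim at once. For the other
  kind it is used twice, in columns \<open>c\<close> and \<open>c + 1\<close>, and
  \<open>fits v c r j\<close> bridges the two uses; the bounds \<open>up\<close> and
  \<open>lo\<close> let \<open>j\<close> stand between the neighbours in row
  \<open>r\<close>.\<close>

lemma fits_old_entry:
  assumes f: "fits v c r j" and up: "v (Suc (Suc c)) r \<le> j" and lo: "j \<le> v c r"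
    and p: "0 < v (Suc c) r" and j: "0 < j"
  shows "fits v c r (v (Suc c) r)"
  unfolding fits_def
proof (intro conjI allI impI)
  fix q assume q: "r < q" and le: "v (Suc c) r \<le> v c q"
  show "v (Suc c) r \<le> v (Suc c) q"
  proof (cases "a r \<le> a q")
    case True then show ?thesis using tripB[OF q True p le] by simp
  next
    case False
    then have aq: "a q < a r" by simp
    have "v c r \<le> v c q" using tripA[OF q aq _ le] le p by simp
    then have "j \<le> v (Suc c) q" using f q lo unfolding fits_def by auto
    then show ?thesis using tripA[OF q aq, of "Suc c"] up j by auto
  qed
next
  fix q assume q: "q < r" and lt: "v (Suc c) r < v (Suc c) q"
  show "v (Suc c) r < v (Suc (Suc c)) q"
  proof (rule ccontr)
    assume n: "\<not> ?thesis"
    show False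
    proof (cases "a r < a q")
      case True then show False using tripA[OF q True p] n lt by auto
    next
      case False
      then have aq: "a q \<le> a r" by simp
      have "v c r < v (Suc c) q" using tripB[OF q aq, of c] lt by force
      then have "j < v (Suc (Suc c)) q" using f q lo unfolding fits_def by auto
      then show False using tripB[OF q aq, of "Suc c"] n up by auto
    qed
  qed
qed

text \<open>The shape is fixed, so every pair of rows keeps its triple condition, and only instances
  reading the cell \<open>(c + 1, r)\<close> need a new argument.\<close>

lemma replace_entry:
  assumes f: "fits v c r j" and up: "v (Suc (Suc c)) r \<le> j" and lo: "j \<le> v c r"
    and p: "0 < v (Suc c) r" and j: "0 < j" and new: "\<And>q. v (Suc c) q \<noteq> j"
  shows "key_filling i a (put v (Suc c) r j)"
proof -
  let ?w = "put v (Suc c) r j"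
  have f1: "\<And>q. r < q \<Longrightarrow> j \<le> v c q \<Longrightarrow> j \<le> v (Suc c) q"
    and f2: "\<And>q. q < r \<Longrightarrow> j < v (Suc c) q \<Longrightarrow> j < v (Suc (Suc c)) q"
    using f unfolding fits_def by auto
  show ?thesis
  proof
    fix r' assume "r' \<notin> {1..i}" then show "a r' = 0" by (rule supp)
  next
    fix d r' show "0 < ?w d r' \<longleftrightarrow> r' \<in> {1..i} \<and> d \<le> a r'"
      using pos[of d r'] p j by (auto simp: put_apply)
  next
    fix r' assume "r' \<in> {1..i}" then show "?w 0 r' = r'" using base by (simp add: put_apply)
  next
    fix d r' show "?w (Suc d) r' \<le> ?w d r'"
      using dec[of d r'] up lo by (auto simp: put_apply)
  next
    fix d r' s assume "?w d r' = ?w d s" "0 < ?w d r'"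
    then show "r' = s" using inj[of d r' s] new[of s] new[of r'] by (auto simp: put_apply split: if_splits)
  next
    fix r' s d
    assume rs: "r' < s" and as: "a s < a r'" and ps: "0 < ?w d s" and le: "?w (Suc d) r' \<le> ?w d s"
    have ps': "0 < v d s" using ps p by (auto simp: put_apply split: if_splits)
    \<comment> \<open>The changed cell is the right cell of the lower row (\<open>l\<close>), the
      single cell of the upper row (\<open>u\<close>), or the left cell of the lower row
      (\<open>u2\<close>).\<close>
    consider (l) "d = c" "r' = r" | (u) "d = Suc c" "s = r" | (u2) "d = Suc c" "r' = r"
      | (o) "\<not> (d = c \<and> r' = r)" "\<not> (d = Suc c \<and> s = r)" "\<not> (d = Suc c \<and> r' = r)" by blast
    then show "?w d r' \<le> ?w d s"
    proof cases
      case l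
      then have "j \<le> v c s" using le by (auto simp: put_apply)
      then have "j \<le> v (Suc c) s" using f1 rs l by auto
      then have "v (Suc c) r \<le> v (Suc c) s" using tripA[OF rs as, of "Suc c"] up j l by auto
      also have "\<dots> \<le> v c s" by (rule dec)
      finally show ?thesis using tripA[OF rs as, of c] l ps' by (auto simp: put_apply)
    next
      case u
      then have "v (Suc (Suc c)) r' \<le> j" using le rs by (auto simp: put_apply)
      then have "v (Suc c) r' \<le> j" using f2[of r'] rs u by (meson not_le)
      then show ?thesis using u rs by (auto simp: put_apply)
    next
      case u2
      then have h: "v (Suc (Suc c)) r \<le> v (Suc c) s" using le rs by (auto simp: put_apply)
      have "v (Suc c) r \<le> v (Suc c) s" using tripA[OF rs as, of "Suc c"] h u2 ps' by auto
      also have "\<dots> \<le> v c s" by (rule dec)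
      finally have "v c r \<le> v c s" using tripA[OF rs as, of c] u2 ps' dec[of c s] by auto
      then have "j \<le> v (Suc c) s" using f1 rs u2 lo by auto
      then show ?thesis using u2 rs by (auto simp: put_apply)
    next
      case o
      then show ?thesis using tripA[OF rs as ps'] le by (auto simp: put_apply)
    qed
  next
    fix r' s d
    assume rs: "r' < s" and as: "a r' \<le> a s" and ps: "0 < ?w (Suc d) r'" and le: "?w (Suc d) r' \<le> ?w d s"
    have ps': "0 < v (Suc d) r'" using ps p by (auto simp: put_apply split: if_splits)
    consider (l) "d = c" "r' = r" | (l2) "d = c" "s = r" | (u) "d = Suc c" "s = r"
      | (o) "\<not> (d = c \<and> r' = r)" "\<not> (d = c \<and> s = r)" "\<not> (d = Suc c \<and> s = r)" by blast
    then show "?w (Suc d) r' \<le> ?w (Suc d) s"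
    proof cases
      case l then show ?thesis using f1 rs le by (auto simp: put_apply)
    next
      case l2
      then have "v (Suc c) r' \<le> v c r" using le rs by (auto simp: put_apply)
      then have o1: "v (Suc c) r' \<le> v (Suc c) r" using tripB[OF rs as ps'] l2 by auto
      have "\<not> j < v (Suc c) r'"
      proof
        assume "j < v (Suc c) r'"
        then have j1: "j < v (Suc (Suc c)) r'" using f2 rs l2 by auto
        then have "v (Suc (Suc c)) r' \<le> v (Suc c) r" using dec[of "Suc c" r'] o1 by linarith
        then have "v (Suc (Suc c)) r' \<le> v (Suc (Suc c)) r"
          using tripB[OF rs as, of "Suc c"] l2 j1 by auto
        then show False using j1 up by simp
      qed
      then show ?thesis using l2 rs by (auto simp: put_apply)
    next
      case u
      then have hj: "v (Suc (Suc c)) r' \<le> j" using le rs by (auto simp: put_apply)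
      have "v (Suc (Suc c)) r' \<le> v (Suc c) r"
      proof (rule ccontr)
        assume n: "\<not> ?thesis"
        then have g: "v (Suc c) r < v (Suc c) r'" using dec[of "Suc c" r'] by linarith
        have "v c r < v (Suc c) r'" using tripB[of r' r c] rs as u g by force
        then show False using f2[of r'] rs u lo hj by auto
      qed
      then have "v (Suc (Suc c)) r' \<le> v (Suc (Suc c)) r" using tripB[OF rs as ps'] u by auto
      then show ?thesis using u by (auto simp: put_apply)
    next
      case o
      then show ?thesis using tripB[OF rs as ps'] le by (auto simp: put_apply)
    qed
  qed
qed

lemma add_entry:
  assumes f: "fits v c r j" and lo: "j \<le> v c r" and r: "r \<in> {1..i}" and ar: "a r = c"
    and top: "\<And>q. r < q \<Longrightarrow> q \<le> i \<Longrightarrow> a q \<noteq> c" and j: "0 < j" and new: "\<And>q. v (Suc c) q \<noteq> j"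
  shows "key_filling i (a(r := Suc c)) (put v (Suc c) r j)"
proof -
  let ?w = "put v (Suc c) r j"
  let ?a = "a(r := Suc c)"
  have f1: "\<And>q. r < q \<Longrightarrow> j \<le> v c q \<Longrightarrow> j \<le> v (Suc c) q"
    and f2: "\<And>q. q < r \<Longrightarrow> j < v (Suc c) q \<Longrightarrow> j < v (Suc (Suc c)) q"
    using f unfolding fits_def by auto
  have zero: "v d r = 0" if "c < d" for d using pos[of d r] ar that by auto
  have zero': "v d q = 0" if "\<not> (q \<in> {1..i} \<and> d \<le> a q)" for d q using pos[of d q] that by auto
  show ?thesis
  proof
    fix r' assume "r' \<notin> {1..i}" then show "?a r' = 0" using supp r by auto
  next
    fix d r' show "0 < ?w d r' \<longleftrightarrow> r' \<in> {1..i} \<and> d \<le> ?a r'"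
      using pos[of d r'] j r ar by (auto simp: put_apply)
  next
    fix r' assume "r' \<in> {1..i}" then show "?w 0 r' = r'" using base by (simp add: put_apply)
  next
    fix d r' show "?w (Suc d) r' \<le> ?w d r'"
      using dec[of d r'] zero[of "Suc (Suc c)"] lo by (auto simp: put_apply)
  next
    fix d r' s assume "?w d r' = ?w d s" "0 < ?w d r'"
    then show "r' = s" using inj[of d r' s] new[of s] new[of r'] by (auto simp: put_apply split: if_splits)
  next
    fix r' s d
    assume rs: "r' < s" and as: "?a s < ?a r'" and ps: "0 < ?w d s" and le: "?w (Suc d) r' \<le> ?w d s"
    consider (r) "r' = r" | (s) "s = r" | (o) "r' \<noteq> r" "s \<noteq> r" by blast
    then show "?w d r' \<le> ?w d s"
    proof cases
      case r
      have ps': "0 < v d s" using ps rs r by (auto simp: put_apply)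
      then have sd: "s \<in> {1..i}" "d \<le> a s" using pos by blast+
      then have "a s < c" using as r rs top[of s] by auto
      then show ?thesis using tripA[of r s d] rs as r ps' le sd ar by (auto simp: put_apply split: if_splits)
    next
      case s
      then have a': "Suc c < a r'" using as rs by auto
      show ?thesis
      proof (cases "d = Suc c")
        case True
        then have "v (Suc (Suc c)) r' \<le> j" using le rs s by (auto simp: put_apply)
        then have "v (Suc c) r' \<le> j" using f2[of r'] rs s by (meson not_le)
        then show ?thesis using s True rs by (auto simp: put_apply)
      next
        case False
        then show ?thesis using tripA[of r' r d] rs s a' ps le ar by (auto simp: put_apply split: if_splits)
      qed
    next
      case o
      then show ?thesis using tripA[OF rs, of d] as ps le by (auto simp: put_apply)
    qed
  next
    fix r' s d
    assume rs: "r' < s" and as: "?a r' \<le> ?a s" and ps: "0 < ?w (Suc d) r'" and le: "?w (Suc d) r' \<le> ?w d s"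
    consider (r) "r' = r" | (s) "s = r" | (o) "r' \<noteq> r" "s \<noteq> r" by blast
    then show "?w (Suc d) r' \<le> ?w (Suc d) s"
    proof cases
      case r
      then have a': "Suc c \<le> a s" using rs as by auto
      have "Suc d \<le> Suc c"
      proof (rule ccontr)
        assume "\<not> Suc d \<le> Suc c"
        then show False using ps zero[of "Suc d"] r by (auto simp: put_apply)
      qed
      then show ?thesis using r rs f1[of s] le tripB[of r s d] ps a' ar by (auto simp: put_apply split: if_splits)
    next
      case s
      then have a1: "a r' \<le> Suc c" using rs as by auto
      have p1: "0 < v (Suc d) r'" using ps rs s by (auto simp: put_apply)
      then have r'i: "r' \<in> {1..i}" and d1: "Suc d \<le> a r'" using pos by blast+
      show ?thesis
      proof (cases "a r' \<le> c")
        case True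
        then show ?thesis using tripB[of r' r d] rs s p1 d1 le ar by (auto simp: put_apply split: if_splits)
      next
        case False
        then have a': "a r' = Suc c" using a1 by simp
        have h0: "v (Suc (Suc c)) r' = 0" using zero' a' by auto
        then have gj: "v (Suc c) r' < j" using f2[of r'] rs s new[of r'] by (metis nat_neq_iff not_less_zero)
        \<comment> \<open>Row \<open>r'\<close> now falls under \<open>tripB\<close> in all columns,
          not only next to the new cell. If it were larger than row \<open>r\<close> anywhere, the
          old \<open>tripA\<close> would keep it larger up to column \<open>c\<close> and even give
          \<open>v c r < v (Suc c) r'\<close>, against
          \<open>v (Suc c) r' < j \<le> v c r\<close>.\<close>
        have cross: "v e r' < v e r" if "e \<le> c" for e
        proof (rule ccontr)
          assume n: "\<not> v e r' < v e r"
          have pe: "0 < v e' r" if "e' \<le> c" for e' using pos[of e' r] assms(3) ar that by auto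
          have ne: "v e' r' \<noteq> v e' r" if "e' \<le> c" for e' using inj[of e' r r'] pe[OF that] rs s by auto
          have "v e' r < v e' r'" if "e \<le> e'" "e' \<le> c" for e'
            using that
          proof (induction e' rule: dec_induct)
            case base then show ?case using n ne by force
          next
            case (step k)
            then have k: "v k r < v k r'" "k \<le> c" by auto
            have "v k r < v (Suc k) r'"
              using tripA[of r' r k] rs s a' ar pe[OF k(2)] k(1) by force
            then show ?case using dec[of k r] by linarith
          qed
          then have lt: "v c r < v c r'" using \<open>e \<le> c\<close> by auto
          have "v c r < v (Suc c) r'"
            using tripA[of r' r c] rs s a' ar pe[of c] lt by force
          then show False using gj lo by simp
        qed
        show ?thesis
        proof (cases "d = c")
          case True then show ?thesis using gj rs s by (auto simp: put_apply)
        next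
          case False
          then have "d < c" using d1 a' by auto
          then show ?thesis using cross[of "Suc d"] rs s by (auto simp: put_apply)
        qed
      qed
    next
      case o
      then show ?thesis using tripB[OF rs, of d] as ps le by (auto simp: put_apply)
    qed
  qed
qed

text \<open>Lower rows of length \<open>c + 1\<close> switch from \<open>tripB\<close> to
  \<open>tripA\<close>, whose conclusion then holds outright by \<open>below_increasing\<close>. The
  last two claims prepare the reverse route: the vacated cell is a legal place for the removed
  entry, and any other row of column \<open>c + 1\<close> where a reverse bump could happen lies
  above \<open>r\<close>.\<close>

lemma remove_entry:
  assumes ar: "a r = Suc c" and top: "\<And>q. r < q \<Longrightarrow> q \<le> i \<Longrightarrow> a q \<noteq> c"
  shows "key_filling i (a(r := c)) (put v (Suc c) r 0)"
    and "fits (put v (Suc c) r 0) c r (v (Suc c) r)"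
    and "q \<noteq> r \<Longrightarrow> v (Suc (Suc c)) q \<le> v (Suc c) r \<Longrightarrow> v (Suc c) r < v (Suc c) q \<Longrightarrow> r < q"
proof -
  let ?w = "put v (Suc c) r 0"
  let ?a = "a(r := c)"
  have r: "r \<in> {1..i}" using supp ar by fastforce
  have p: "0 < v (Suc c) r" using pos ar r by auto
  have cross: "v d q < v d r" if "q < r" "a q = Suc c" "q \<in> {1..i}" "d \<le> Suc c" for q d
    using below_increasing[of q r d] that ar r by auto
  have zero': "v d q = 0" if "\<not> (q \<in> {1..i} \<and> d \<le> a q)" for d q using pos[of d q] that by auto
  have pt: "q \<in> {1..i}" "d \<le> a q" if "0 < v d q" for d q using that pos by blast+
  show low: "r < q" if "q \<noteq> r" "v (Suc (Suc c)) q \<le> v (Suc c) r" "v (Suc c) r < v (Suc c) q" for q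
  proof (rule ccontr)
    assume "\<not> r < q"
    then have q: "q < r" using that by simp
    have qa: "q \<in> {1..i}" "Suc c \<le> a q" using pt[of "Suc c" q] that by auto
    show False
    proof (cases "a q = Suc c")
      case True then show False using cross[OF q True qa(1), of "Suc c"] that by auto
    next
      case False
      then show False using tripA[of q r "Suc c"] q qa ar p that by auto
    qed
  qed
  show "fits ?w c r (v (Suc c) r)"
    unfolding fits_def
  proof (intro conjI allI impI)
    fix q assume q: "r < q" "v (Suc c) r \<le> ?w c q"
    then have le: "v (Suc c) r \<le> v c q" by (simp add: put_apply)
    then have "0 < v c q" using p by simp
    then have "Suc c \<le> a q" using pt[of c q] top[of q] q by force
    then show "v (Suc c) r \<le> ?w (Suc c) q" using tripB[of r q c] q le p ar by (auto simp: put_apply)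
  next
    fix q assume q: "q < r" "v (Suc c) r < ?w (Suc c) q"
    then show "v (Suc c) r < ?w (Suc (Suc c)) q" using low[of q] by (auto simp: put_apply intro: ccontr)
  qed
  show "key_filling i ?a ?w"
  proof
    fix r' assume "r' \<notin> {1..i}" then show "?a r' = 0" using supp r by auto
  next
    fix d r' show "0 < ?w d r' \<longleftrightarrow> r' \<in> {1..i} \<and> d \<le> ?a r'"
      using pos[of d r'] r ar by (auto simp: put_apply)
  next
    fix r' assume "r' \<in> {1..i}" then show "?w 0 r' = r'" using base by (simp add: put_apply)
  next
    fix d r' show "?w (Suc d) r' \<le> ?w d r'"
      using dec[of d r'] zero'[of r "Suc (Suc c)"] ar by (auto simp: put_apply)
  next
    fix d r' s assume "?w d r' = ?w d s" "0 < ?w d r'"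
    then show "r' = s" using inj[of d r' s] by (auto simp: put_apply split: if_splits)
  next
    fix r' s d
    assume rs: "r' < s" and as: "?a s < ?a r'" and ps: "0 < ?w d s" and le: "?w (Suc d) r' \<le> ?w d s"
    have ps': "0 < v d s" using ps by (auto simp: put_apply split: if_splits)
    have pts: "s \<in> {1..i}" "d \<le> a s" using pt[OF ps'] by auto
    consider (r) "r' = r" | (s) "s = r" | (o) "r' \<noteq> r" "s \<noteq> r" by blast
    then show "?w d r' \<le> ?w d s"
    proof cases
      case r
      then have a': "a s < c" using as rs by auto
      then show ?thesis using tripA[of r s d] r rs as ar ps' le pts by (auto simp: put_apply split: if_splits)
    next
      case s
      then have a': "c < a r'" using as rs by auto
      have "d \<le> Suc c" using pts s ar by simp
      moreover have "d \<noteq> Suc c" using ps s by (auto simp: put_apply)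
      ultimately have dc: "d \<le> c" by simp
      have r'i: "r' \<in> {1..i}" using supp a' by fastforce
      show ?thesis
      proof (cases "a r' = Suc c")
        case True
        then show ?thesis using cross[of r' d] rs s r'i dc by (auto simp: put_apply)
      next
        case False
        then show ?thesis using tripA[of r' r d] rs s a' ar ps' le dc by (auto simp: put_apply split: if_splits)
      qed
    next
      case o
      then show ?thesis using tripA[OF rs, of d] as ps le by (auto simp: put_apply)
    qed
  next
    fix r' s d
    assume rs: "r' < s" and as: "?a r' \<le> ?a s" and ps: "0 < ?w (Suc d) r'" and le: "?w (Suc d) r' \<le> ?w d s"
    have ps': "0 < v (Suc d) r'" using ps by (auto simp: put_apply split: if_splits)
    have pts: "r' \<in> {1..i}" "Suc d \<le> a r'" using pt[OF ps'] by auto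
    consider (r) "r' = r" | (s) "s = r" | (o) "r' \<noteq> r" "s \<noteq> r" by blast
    then show "?w (Suc d) r' \<le> ?w (Suc d) s"
    proof cases
      case r
      have dc: "Suc d \<le> c" using ps zero'[of r "Suc d"] ar r pts by (auto simp: put_apply split: if_splits)
      have si: "s \<le> i"
      proof (rule ccontr)
        assume "\<not> s \<le> i"
        then have "a s = 0" using supp by auto
        then show False using as r rs dc by auto
      qed
      then have "Suc c \<le> a s" using as r rs top[of s] by auto
      then show ?thesis using tripB[of r s d] r rs ar ps' le dc by (auto simp: put_apply split: if_splits)
    next
      case s
      then have "a r' \<le> c" using as rs by auto
      then show ?thesis using tripB[of r' r d] rs s ar ps' le pts by (auto simp: put_apply split: if_splits)
    next
      case o
      then show ?thesis using tripB[OF rs, of d] as ps le by (auto simp: put_apply)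
    qed
  qed
qed

end

section \<open>Flagged insertion\<close>

definition key_filling_of :: "nat \<Rightarrow> (nat \<Rightarrow> nat) \<Rightarrow> filling \<Rightarrow> bool" where
  "key_filling_of i a S \<longleftrightarrow> key_filling i a (entry i S) \<and> dom S = key_diagram a"

definition cnt :: "(nat \<Rightarrow> nat \<Rightarrow> nat) \<Rightarrow> nat \<Rightarrow> nat \<Rightarrow> nat" where
  "cnt v c t = card {r. t \<le> v c r}"

lemma entry_0: "entry i S 0 r = (if r \<in> {1..i} then r else 0)"
  by (simp add: entry_def hat_def)

lemma entry_Suc: "entry i S (Suc c) r = (case S (Suc c, r) of None \<Rightarrow> 0 | Some x \<Rightarrow> x)"
  by (simp add: entry_def hat_def)

lemma entry_upd: "entry i (S((Suc c, r) \<mapsto> j)) = put (entry i S) (Suc c) r j"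
  by (auto simp: fun_eq_iff entry_def hat_def put_def)

lemma entry_del: "entry i (S((Suc c, r) := None)) = put (entry i S) (Suc c) r 0"
  by (auto simp: fun_eq_iff entry_def hat_def put_def)

lemma count_ge_entry: "0 < t \<Longrightarrow> count_ge (hat i S) t c = cnt (entry i S) c t"
  unfolding count_ge_def cnt_def entry_def
  by (rule arg_cong[where f = card]) (auto split: option.splits)

lemma insertion_rows_entry:
  "0 < j \<Longrightarrow> insertion_rows i S (Suc c) j = {r \<in> {1..i}. j \<le> entry i S c r \<and> entry i S (Suc c) r < j}"
  unfolding insertion_rows_def entry_def by (auto split: option.splits)

lemma finite_ge:
  assumes "key_filling i a v" "0 < t"
  shows "finite {r. t \<le> v c r}"
proof (rule finite_subset)
  show "{r. t \<le> v c r} \<subseteq> {1..i}"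
  proof
    fix r assume "r \<in> {r. t \<le> v c r}"
    then have "0 < v c r" using assms(2) by simp
    then show "r \<in> {1..i}" using key_filling.pos[OF assms(1)] by blast
  qed
qed simp

lemma cnt_put:
  assumes "key_filling i a v" "0 < x" "v c r < j"
  shows "cnt (put v c r j) d x = cnt v d x + (if d = c \<and> v c r < x \<and> x \<le> j then 1 else 0)"
proof (cases "d = c \<and> v c r < x \<and> x \<le> j")
  case True
  then have "{q. x \<le> put v c r j d q} = insert r {q. x \<le> v d q}" "r \<notin> {q. x \<le> v d q}"
    by (auto simp: put_apply)
  then show ?thesis using True finite_ge[OF assms(1,2), of d] unfolding cnt_def by simp
next
  case False
  then have "{q. x \<le> put v c r j d q} = {q. x \<le> v d q}" using assms(3) by (auto simp: put_apply)
  then show ?thesis unfolding cnt_def by (simp only: False if_False add_0_right)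
qed

section \<open>Column counts of a key tableau\<close>

context key_filling
begin

lemma fin: "0 < t \<Longrightarrow> finite {r. t \<le> v c r}"
  by (rule finite_ge) unfold_locales

lemma cnt_Suc_le: "0 < t \<Longrightarrow> cnt v (Suc c) t \<le> cnt v c t"
  unfolding cnt_def by (rule card_mono[OF fin]) (auto intro: order_trans[OF _ dec])

lemma cnt_less_iff:
  assumes "0 < t"
  shows "cnt v (Suc c) t < cnt v c t \<longleftrightarrow> (\<exists>r. t \<le> v c r \<and> v (Suc c) r < t)"
proof
  assume "cnt v (Suc c) t < cnt v c t"
  then show "\<exists>r. t \<le> v c r \<and> v (Suc c) r < t"
    unfolding cnt_def using card_mono[OF fin[OF assms, of "Suc c"], of "{r. t \<le> v c r}"]
    by (force simp: not_less)
next
  assume "\<exists>r. t \<le> v c r \<and> v (Suc c) r < t"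
  then obtain r where r: "t \<le> v c r" "v (Suc c) r < t" by blast
  then have "r \<in> {r. t \<le> v c r} - {r. t \<le> v (Suc c) r}" by simp
  moreover have "{r. t \<le> v (Suc c) r} \<subseteq> {r. t \<le> v c r}"
    by (auto intro: order_trans[OF _ dec])
  ultimately have "{r. t \<le> v (Suc c) r} \<subset> {r. t \<le> v c r}" by blast
  then show "cnt v (Suc c) t < cnt v c t"
    unfolding cnt_def by (rule psubset_card_mono[OF fin[OF assms]])
qed

lemma cnt_step: "0 < t \<Longrightarrow> cnt v c t \<le> Suc (cnt v c (Suc t))"
proof -
  assume t: "0 < t"
  show ?thesis
  proof (cases "\<exists>r. v c r = t")
    case True
    then obtain r where r: "v c r = t" by blast
    have "{q. t \<le> v c q} \<subseteq> insert r {q. Suc t \<le> v c q}"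
    proof
      fix q assume "q \<in> {q. t \<le> v c q}"
      then show "q \<in> insert r {q. Suc t \<le> v c q}" using inj[of c r q] r t by (cases "v c q = t") auto
    qed
    then have "card {q. t \<le> v c q} \<le> card (insert r {q. Suc t \<le> v c q})"
      by (rule card_mono[rotated]) (simp add: fin)
    also have "\<dots> \<le> Suc (card {q. Suc t \<le> v c q})" by (rule card_insert_le_m1) simp_all
    finally show ?thesis unfolding cnt_def .
  next
    case False
    then have "{q. t \<le> v c q} = {q. Suc t \<le> v c q}" by (auto simp: Suc_le_eq le_less)
    then show ?thesis unfolding cnt_def by simp
  qed
qed

lemma cnt_Suc_t_le: "0 < t \<Longrightarrow> cnt v c (Suc t) \<le> cnt v c t"
  unfolding cnt_def by (rule card_mono[OF fin]) auto

text \<open>If column \<open>N + 1\<close> omits \<open>j\<close> and offers no place for it, then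
  column \<open>N\<close> omits \<open>j\<close> too, because rows decrease. This walk to the left
  must stop, since the basement contains \<open>j\<close>; here the flag condition
  \<open>j \<le> i\<close> enters.\<close>

lemma exists_column:
  assumes "\<And>q. v N q \<noteq> j" and j: "j \<in> {1..i}"
  shows "\<exists>c<N. (\<exists>r. j \<le> v c r \<and> v (Suc c) r < j) \<and> (\<forall>q. v (Suc c) q \<noteq> j) \<and>
    (\<forall>d. c < d \<and> d < N \<longrightarrow> (\<forall>q. v (Suc d) q \<noteq> j) \<and> (\<forall>r. j \<le> v d r \<longrightarrow> j \<le> v (Suc d) r))"
  using assms(1)
proof (induction N)
  case 0
  then show ?case using base[OF j] by blast
next
  case (Suc N)
  show ?case
  proof (cases "\<exists>r. j \<le> v N r \<and> v (Suc N) r < j")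
    case True
    then show ?thesis using Suc.prems by (intro exI[of _ N]) auto
  next
    case False
    then have t: "\<And>r. j \<le> v N r \<Longrightarrow> j \<le> v (Suc N) r" by (meson not_le)
    have "\<And>q. v N q \<noteq> j"
    proof
      fix q assume "v N q = j"
      then have "v (Suc N) q = j" using t[of q] dec[of N q] by simp
      then show False using Suc.prems by blast
    qed
    from Suc.IH[OF this] obtain c where c: "c < N" "\<exists>r. j \<le> v c r \<and> v (Suc c) r < j" "\<forall>q. v (Suc c) q \<noteq> j"
      "\<forall>d. c < d \<and> d < N \<longrightarrow> (\<forall>q. v (Suc d) q \<noteq> j) \<and> (\<forall>r. j \<le> v d r \<longrightarrow> j \<le> v (Suc d) r)" by blast
    show ?thesis
      by (rule exI[of _ c]) (use c t Suc.prems in \<open>auto simp: less_Suc_eq\<close>)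
  qed
qed

end

lemma key_filling_ofD:
  assumes "key_filling_of i a S"
  shows "key_filling i a (entry i S)" "dom S = key_diagram a"
    "S (Suc c, r) = None \<longleftrightarrow> entry i S (Suc c) r = 0"
    "0 < entry i S (Suc c) r \<Longrightarrow> S (Suc c, r) = Some (entry i S (Suc c) r)"
proof -
  show k: "key_filling i a (entry i S)" and d: "dom S = key_diagram a"
    using assms unfolding key_filling_of_def by auto
  have "S (Suc c, r) \<noteq> None \<longleftrightarrow> Suc c \<le> a r" using d by (auto simp: dom_def key_diagram_def set_eq_iff)
  moreover have "Suc c \<le> a r \<longleftrightarrow> 0 < entry i S (Suc c) r"
    using key_filling.pos[OF k, of "Suc c" r] key_filling.supp[OF k, of r] by fastforce
  ultimately show "S (Suc c, r) = None \<longleftrightarrow> entry i S (Suc c) r = 0" by auto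
  show "S (Suc c, r) = Some (entry i S (Suc c) r)" if "0 < entry i S (Suc c) r"
    using that by (auto simp: entry_Suc split: option.splits)
qed

lemma finite_dom_key_filling:
  assumes "key_filling_of i a S" shows "finite (dom S)"
proof -
  have k: "key_filling i a (entry i S)" and d: "dom S = key_diagram a" using assms unfolding key_filling_of_def by auto
  have "key_diagram a \<subseteq> (\<Union>r\<in>{1..i}. (\<lambda>c. (c, r)) ` {1..a r})"
  proof
    fix x assume "x \<in> key_diagram a"
    then obtain c r where x: "x = (c, r)" "1 \<le> c" "c \<le> a r" by (auto simp: key_diagram_def)
    then have "r \<in> {1..i}" using key_filling.supp[OF k, of r] by fastforce
    then show "x \<in> (\<Union>r\<in>{1..i}. (\<lambda>c. (c, r)) ` {1..a r})" using x by (intro UN_I[of r]) auto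
  qed
  then show ?thesis unfolding d by (rule finite_subset) auto
qed

lemma wt_add:
  assumes "finite (dom S)" "S x = None"
  shows "wt (S(x \<mapsto> j)) k = wt S k + (if k = j then 1 else 0)"
proof -
  have f: "finite {y. S y = Some k}" by (rule finite_subset[OF _ assms(1)]) auto
  have "{y. (S(x \<mapsto> j)) y = Some k} = (if k = j then insert x {y. S y = Some k} else {y. S y = Some k})"
    using assms(2) by auto
  moreover have "x \<notin> {y. S y = Some k}" using assms(2) by simp
  ultimately show ?thesis using f unfolding wt_def by (cases "k = j") (simp_all del: fun_upd_apply)
qed

lemma wt_replace:
  assumes "finite (dom S)" "S x = Some y"
  shows "wt (S(x \<mapsto> j)) k + (if k = y then 1 else 0) = wt S k + (if k = j then 1 else 0)"
proof -
  define S0 where "S0 = S(x := None)"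
  have d: "finite (dom S0)" "S0 x = None" using assms(1) by (auto simp: S0_def)
  have "S0(x \<mapsto> j) = S(x \<mapsto> j)" "S0(x \<mapsto> y) = S" using assms(2) by (auto simp: S0_def)
  then show ?thesis using wt_add[OF d, of j k] wt_add[OF d, of y k] by simp
qed

section \<open>Unfolding a single bump of the loop\<close>

lemma insertion_column_eq:
  assumes k: "key_filling i a (entry i S)" and j: "0 < j" and C: "enat (Suc c) \<le> C"
    and ex: "j \<le> entry i S c r" "entry i S (Suc c) r < j"
    and all: "\<And>d r. c < d \<Longrightarrow> enat (Suc d) \<le> C \<Longrightarrow> j \<le> entry i S d r \<Longrightarrow> j \<le> entry i S (Suc d) r"
  shows "insertion_column i S C j = Suc c"
proof -
  let ?X = "{c'. 1 \<le> c' \<and> enat c' \<le> C \<and> count_ge (hat i S) j c' < count_ge (hat i S) j (c' - 1)}"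
  have m: "Suc c \<in> ?X"
    using C key_filling.cnt_less_iff[OF k j, of c] ex by (auto simp: count_ge_entry[OF j])
  have le: "x \<le> Suc c" if "x \<in> ?X" for x
  proof (rule ccontr)
    assume n: "\<not> x \<le> Suc c"
    then obtain d where d: "x = Suc d" "c < d" by (cases x) auto
    then have "cnt (entry i S) (Suc d) j < cnt (entry i S) d j" "enat (Suc d) \<le> C"
      using that by (auto simp: count_ge_entry[OF j])
    then show False using key_filling.cnt_less_iff[OF k j, of d] all[OF d(2)] by (meson not_le)
  qed
  have "finite ?X" by (rule finite_subset[of _ "{..Suc c}"]) (use le in auto)
  then show ?thesis unfolding insertion_column_def using m le by (intro Max_eqI) auto
qed

lemma insertion_column_bound:
  assumes k: "key_filling i a (entry i S)" and j: "0 < j" and C: "enat N \<le> C"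
    and all: "\<And>d r. N \<le> d \<Longrightarrow> enat (Suc d) \<le> C \<Longrightarrow> j \<le> entry i S d r \<Longrightarrow> j \<le> entry i S (Suc d) r"
  shows "insertion_column i S C j = insertion_column i S (enat N) j"
proof -
  have "1 \<le> x \<and> enat x \<le> C \<and> count_ge (hat i S) j x < count_ge (hat i S) j (x - 1)
     \<longleftrightarrow> 1 \<le> x \<and> enat x \<le> enat N \<and> count_ge (hat i S) j x < count_ge (hat i S) j (x - 1)" for x
  proof (cases "x \<le> N")
    case True
    then have "enat x \<le> enat N" by simp
    moreover from this C have "enat x \<le> C" by (rule order_trans)
    ultimately show ?thesis by simp
  next
    case False
    then obtain d where d: "x = Suc d" "N \<le> d" by (cases x) auto
    then show ?thesis
      using key_filling.cnt_less_iff[OF k j, of d] all[OF d(2)] by (auto simp: count_ge_entry[OF j] not_le[symmetric])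
  qed
  then show ?thesis unfolding insertion_column_def by presburger
qed

text \<open>Columns beyond \<open>N\<close> that offer no place can be ignored. This replaces the
  initial bound \<open>\<infinity>\<close> by a finite one and lets the reverse route change its
  starting column.\<close>

lemma loop_bound:
  assumes "key_filling i a (entry i S)" "0 < j" "enat N \<le> C"
    and "\<And>d r. N \<le> d \<Longrightarrow> enat (Suc d) \<le> C \<Longrightarrow> j \<le> entry i S d r \<Longrightarrow> j \<le> entry i S (Suc d) r"
  shows "flagged_insert_loop i C S j = flagged_insert_loop i (enat N) S j"
  unfolding flagged_insert_loop.simps[of i C S j] flagged_insert_loop.simps[of i "enat N" S j]
  by (simp only: insertion_column_bound[OF assms])

lemma loop_step:
  assumes k: "key_filling i a (entry i S)" and j: "0 < j" and C: "enat (Suc c) \<le> C"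
    and r: "j \<le> entry i S c r" "entry i S (Suc c) r < j"
    and top: "\<And>q. r < q \<Longrightarrow> j \<le> entry i S c q \<Longrightarrow> j \<le> entry i S (Suc c) q"
    and all: "\<And>d r. c < d \<Longrightarrow> enat (Suc d) \<le> C \<Longrightarrow> j \<le> entry i S d r \<Longrightarrow> j \<le> entry i S (Suc d) r"
  shows "flagged_insert_loop i C S j =
    (case S (Suc c, r) of None \<Rightarrow> S((Suc c, r) \<mapsto> j)
     | Some j' \<Rightarrow> flagged_insert_loop i (enat (Suc c)) (S((Suc c, r) \<mapsto> j)) j')"
proof -
  have col: "insertion_column i S C j = Suc c" by (rule insertion_column_eq[OF k j C r all])
  have "r \<in> {1..i}" using key_filling.pos[OF k, of c r] r j by auto
  then have m: "r \<in> insertion_rows i S (Suc c) j" using r by (simp add: insertion_rows_entry[OF j])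
  have "q \<le> r" if "q \<in> insertion_rows i S (Suc c) j" for q
    using that top[of q] by (force simp: insertion_rows_entry[OF j] not_le[symmetric])
  moreover have "finite (insertion_rows i S (Suc c) j)" by (simp add: insertion_rows_def)
  ultimately have "Max (insertion_rows i S (Suc c) j) = r" using m by (intro Max_eqI) auto
  then show ?thesis using m unfolding flagged_insert_loop.simps[of i C S j] col Let_def by auto
qed

text \<open>The value \<open>m d\<close> is the entry that arrives at column \<open>d\<close> from the right and \<open>m (d - 1)\<close> is the one that
  leaves it, where several bumps within a column are composed; \<open>m d = 0\<close> means that the route has ended,
  which happens in column \<open>k\<close>. The numbers \<open>F d x\<close> count the entries \<open>\<ge> x\<close> of column \<open>d\<close>.\<close>

definition bump_path :: "nat \<Rightarrow> (nat \<Rightarrow> nat \<Rightarrow> nat) \<Rightarrow> nat \<Rightarrow> (nat \<Rightarrow> nat) \<Rightarrow> nat \<Rightarrow> bool" where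
  "bump_path N F j m k \<longleftrightarrow>
     1 \<le> k \<and> (\<forall>d. m d \<le> m (Suc d)) \<and> (\<forall>d. m d = 0 \<longleftrightarrow> d < k) \<and> (\<forall>d\<ge>N. m d = j) \<and>
     (\<forall>d. k \<le> d \<and> d < N \<longrightarrow> F (Suc d) (m d) = F d (m d)) \<and>
     (\<forall>d x. m d < x \<and> x \<le> m (Suc d) \<longrightarrow> F (Suc d) x < F d x)"

text \<open>These are the counts after the insertion: column \<open>d\<close> receives
  \<open>m d\<close> and gives up \<open>m (d - 1)\<close>, so exactly the thresholds between them
  gain one. Truncated subtraction leaves the basement column unchanged.\<close>

definition shift :: "(nat \<Rightarrow> nat \<Rightarrow> nat) \<Rightarrow> (nat \<Rightarrow> nat) \<Rightarrow> nat \<Rightarrow> nat \<Rightarrow> nat" where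
  "shift F m d x = F d x + (if m (d - 1) < x \<and> x \<le> m d then 1 else 0)"

text \<open>The last hypothesis is the loop invariant: the second half of \<open>fits\<close> for
  whichever row is chosen in column \<open>M + 1\<close>. The first half comes from choosing the
  topmost row. If the loop stops further left, the second half is automatic, since the column to the
  right omits \<open>j\<close> and offered no place for it. Removed entries decrease, hence the
  induction on \<open>j\<close>.\<close>

lemma flagged_insert_loop_key_filling:
  assumes "key_filling_of i a S" "j \<in> {1..i}" "\<And>q. entry i S (Suc M) q \<noteq> j"
    and "\<And>r q. \<lbrakk>entry i S (Suc M) r < j; j \<le> entry i S M r; q < r; j < entry i S (Suc M) q\<rbrakk>
      \<Longrightarrow> j < entry i S (Suc (Suc M)) q"
  shows "\<exists>r m k. key_filling_of i (a(r := k)) (flagged_insert_loop i (enat (Suc M)) S j) \<and>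
    r \<in> {1..i} \<and> Suc (a r) = k \<and> (\<forall>q. r < q \<and> q \<le> i \<longrightarrow> a q \<noteq> a r) \<and>
    bump_path (Suc M) (cnt (entry i S)) j m k \<and>
    (\<forall>d x. 0 < x \<longrightarrow> cnt (entry i (flagged_insert_loop i (enat (Suc M)) S j)) d x = shift (cnt (entry i S)) m d x) \<and>
    (\<forall>l. wt (flagged_insert_loop i (enat (Suc M)) S j) l = wt S l + (if l = j then 1 else 0))"
  using assms
proof (induction j arbitrary: S M rule: less_induct)
  case (less j S M)
  let ?v = "entry i S"
  note kd = key_filling_ofD[OF less.prems(1)]
  interpret key_filling i a ?v by (rule kd(1))
  have j: "0 < j" using less.prems(2) by simp
  obtain c where c: "c < Suc M" and ex: "\<exists>r. j \<le> ?v c r \<and> ?v (Suc c) r < j" and new: "\<And>q. ?v (Suc c) q \<noteq> j"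
    and later: "\<And>d. c < d \<Longrightarrow> d < Suc M \<Longrightarrow> (\<forall>q. ?v (Suc d) q \<noteq> j) \<and> (\<forall>r. j \<le> ?v d r \<longrightarrow> j \<le> ?v (Suc d) r)"
    using exists_column[OF less.prems(3,2)] by blast
  let ?R = "{r. j \<le> ?v c r \<and> ?v (Suc c) r < j}"
  have finR: "finite ?R" by (rule finite_subset[OF _ fin[OF j, of c]]) auto
  define r where "r = Max ?R"
  have rR: "r \<in> ?R" unfolding r_def by (rule Max_in[OF finR]) (use ex in blast)
  have lo: "j \<le> ?v c r" and gj: "?v (Suc c) r < j" using rR by auto
  have top: "j \<le> ?v (Suc c) q" if "r < q" "j \<le> ?v c q" for q
  proof (rule ccontr)
    assume "\<not> ?thesis"
    then have "q \<in> ?R" using that by simp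
    then have "q \<le> r" unfolding r_def by (rule Max_ge[OF finR])
    then show False using that by simp
  qed
  have inv: "j < ?v (Suc (Suc c)) q" if "q < r" "j < ?v (Suc c) q" for q
  proof (cases "c = M")
    case True then show ?thesis using less.prems(4)[of r q] lo gj that by simp
  next
    case False
    then have "(\<forall>q. ?v (Suc (Suc c)) q \<noteq> j) \<and> (\<forall>r. j \<le> ?v (Suc c) r \<longrightarrow> j \<le> ?v (Suc (Suc c)) r)"
      using later[of "Suc c"] c by simp
    then have "?v (Suc (Suc c)) q \<noteq> j" "j \<le> ?v (Suc (Suc c)) q" using that(2) by (simp_all add: less_imp_le)
    then show ?thesis by simp
  qed
  have f: "fits ?v c r j" unfolding fits_def using top inv by blast
  have ri: "r \<in> {1..i}" using pos[of c r] lo j by auto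
  have up: "?v (Suc (Suc c)) r \<le> j" using dec[of "Suc c" r] gj by simp
  let ?S = "S((Suc c, r) \<mapsto> j)"
  have vS: "entry i ?S = put ?v (Suc c) r j" by (rule entry_upd)
  have cS: "cnt (entry i ?S) d x = cnt ?v d x + (if d = Suc c \<and> ?v (Suc c) r < x \<and> x \<le> j then 1 else 0)"
    if "0 < x" for d x unfolding vS by (rule cnt_put[OF kd(1) that gj])
  have tight: "cnt ?v (Suc d) j = cnt ?v d j" if "c < d" "d < Suc M" for d
    using cnt_less_iff[OF j, of d] cnt_Suc_le[OF j, of d] later[OF that] by (meson le_neq_implies_less not_le)
  have step: "flagged_insert_loop i (enat (Suc M)) S j =
    (case S (Suc c, r) of None \<Rightarrow> ?S | Some j' \<Rightarrow> flagged_insert_loop i (enat (Suc c)) ?S j')"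
    by (rule loop_step[OF kd(1) j _ lo gj top]) (use c later in auto)
  show ?case
  proof (cases "?v (Suc c) r = 0")
    case True
    then have none: "S (Suc c, r) = None" using kd(3) by simp
    have ar: "a r = c" using pos[of "Suc c" r] pos[of c r] True lo j ri by auto
    \<comment> \<open>A higher row of length \<open>c\<close> would have a larger entry in column
      \<open>c\<close> with an empty cell next to it, and the loop would have chosen that row
      instead.\<close>
    have atop: "a q \<noteq> c" if "r < q" "q \<le> i" for q
    proof
      assume q: "a q = c"
      have qi: "q \<in> {1..i}" using that ri by auto
      have "?v c r < ?v c q" by (rule below_increasing) (use that q ar ri qi in auto)
      then have "j \<le> ?v (Suc c) q" using top[OF that(1)] lo by simp
      then show False using pos[of "Suc c" q] q j by auto
    qed
    have kf: "key_filling i (a(r := Suc c)) (entry i ?S)"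
      unfolding vS by (rule add_entry[OF f lo ri ar atop j new])
    have dm: "dom ?S = key_diagram (a(r := Suc c))"
      using kd(2) ar by (auto simp: key_diagram_def)
    have P: "bump_path (Suc M) (cnt ?v) j (\<lambda>d. if Suc c \<le> d then j else 0) (Suc c)"
      unfolding bump_path_def
    proof (intro conjI allI impI)
      fix d x assume x: "(if Suc c \<le> d then j else 0) < x \<and> x \<le> (if Suc c \<le> Suc d then j else 0)"
      then have dc: "d = c" by (auto split: if_splits)
      then show "cnt ?v (Suc d) x < cnt ?v d x"
        using cnt_less_iff[of x c] x True lo by (auto intro!: exI[of _ r])
    qed (use j c tight in \<open>auto simp: Suc_le_eq\<close>)
    have C: "cnt (entry i ?S) d x = shift (cnt ?v) (\<lambda>d. if Suc c \<le> d then j else 0) d x" if "0 < x" for d x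
      unfolding cS[OF that] shift_def using True that by (cases d) auto
    have "flagged_insert_loop i (enat (Suc M)) S j = ?S" using step none by simp
    moreover have "key_filling_of i (a(r := Suc c)) ?S" unfolding key_filling_of_def using kf dm by blast
    moreover have "wt ?S l = wt S l + (if l = j then 1 else 0)" for l
      by (rule wt_add[OF finite_dom_key_filling[OF less.prems(1)] none])
    moreover have "\<forall>q. r < q \<and> q \<le> i \<longrightarrow> a q \<noteq> a r" using atop ar by simp
    ultimately show ?thesis using ri ar P C by metis
  next
    case False
    define y where "y = ?v (Suc c) r"
    have y: "0 < y" "y < j" "S (Suc c, r) = Some y" using False gj kd(4)[of c r] by (auto simp: y_def)
    have kf: "key_filling i a (entry i ?S)"
      unfolding vS by (rule replace_entry[OF f up lo _ j new]) (use False in simp)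
    have dm: "dom ?S = key_diagram a" using kd(2) y by auto
    have kfo: "key_filling_of i a ?S" unfolding key_filling_of_def using kf dm by simp
    have fy: "fits ?v c r y" unfolding y_def by (rule fits_old_entry[OF f up lo _ j]) (use False in simp)
    have yi: "y \<in> {1..i}" using y less.prems(2) by simp
    have ynew: "entry i ?S (Suc c) q \<noteq> y" for q
      unfolding vS using y inj[of "Suc c" r q] by (auto simp: put_apply y_def)
    \<comment> \<open>By the first half of \<open>fits\<close> for \<open>y\<close>, the next
      candidate \<open>r'\<close> cannot lie above \<open>r\<close>; so \<open>q < r' < r\<close>,
      where the second half applies.\<close>
    have inv': "y < entry i ?S (Suc (Suc c)) q"
      if h: "entry i ?S (Suc c) r' < y" "y \<le> entry i ?S c r'" "q < r'" "y < entry i ?S (Suc c) q" for r' q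
    proof -
      have "r' \<noteq> r" using h(1) y by (auto simp: vS put_apply)
      then have "\<not> r < r'" using fy h(1,2) unfolding fits_def by (auto simp: vS put_apply)
      then have "q < r" using h \<open>r' \<noteq> r\<close> by simp
      then show ?thesis using fy h(4) unfolding fits_def by (auto simp: vS put_apply)
    qed
    have "\<exists>s m k. key_filling_of i (a(s := k)) (flagged_insert_loop i (enat (Suc c)) ?S y) \<and>
      s \<in> {1..i} \<and> Suc (a s) = k \<and> (\<forall>q. s < q \<and> q \<le> i \<longrightarrow> a q \<noteq> a s) \<and>
      bump_path (Suc c) (cnt (entry i ?S)) y m k \<and>
      (\<forall>d x. 0 < x \<longrightarrow> cnt (entry i (flagged_insert_loop i (enat (Suc c)) ?S y)) d x = shift (cnt (entry i ?S)) m d x) \<and>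
      (\<forall>l. wt (flagged_insert_loop i (enat (Suc c)) ?S y) l = wt ?S l + (if l = y then 1 else 0))"
      by (rule less.IH[OF y(2) kfo yi ynew]) (rule inv')
    then obtain s m k where
      IH: "key_filling_of i (a(s := k)) (flagged_insert_loop i (enat (Suc c)) ?S y)"
      "s \<in> {1..i}" "Suc (a s) = k" "\<forall>q. s < q \<and> q \<le> i \<longrightarrow> a q \<noteq> a s"
      and mp: "bump_path (Suc c) (cnt (entry i ?S)) y m k"
      and C: "\<And>d x. 0 < x \<Longrightarrow> cnt (entry i (flagged_insert_loop i (enat (Suc c)) ?S y)) d x = shift (cnt (entry i ?S)) m d x"
      and W: "\<And>l. wt (flagged_insert_loop i (enat (Suc c)) ?S y) l = wt ?S l + (if l = y then 1 else 0)"
      by blast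
    \<comment> \<open>The recursive call may bump again within column \<open>c + 1\<close>, so its
      path starts there with \<open>y\<close>. Composing it with the present bump makes
      \<open>j\<close> the arriving entry and keeps the departing entry \<open>m c\<close>.\<close>
    let ?m = "\<lambda>d. if Suc c \<le> d then j else m d"
    have mp1: "1 \<le> k" "\<And>d. m d \<le> m (Suc d)" "\<And>d. m d = 0 \<longleftrightarrow> d < k" "\<And>d. Suc c \<le> d \<Longrightarrow> m d = y"
      "\<And>d. k \<le> d \<Longrightarrow> d < Suc c \<Longrightarrow> cnt (entry i ?S) (Suc d) (m d) = cnt (entry i ?S) d (m d)"
      "\<And>d x. m d < x \<Longrightarrow> x \<le> m (Suc d) \<Longrightarrow> cnt (entry i ?S) (Suc d) x < cnt (entry i ?S) d x"
      using mp unfolding bump_path_def by auto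
    have my: "m d \<le> y" for d
      using lift_Suc_mono_le[of m d "max d (Suc c)"] mp1(2) mp1(4)[of "max d (Suc c)"] by auto
    have kc: "k \<le> Suc c" using mp1(3)[of "Suc c"] mp1(4)[of "Suc c"] y by (metis not_le order_refl less_irrefl)
    have P: "bump_path (Suc M) (cnt ?v) j ?m k"
      unfolding bump_path_def
    proof (intro conjI allI impI)
      show "1 \<le> k" by fact
    next
      fix d show "?m d \<le> ?m (Suc d)" using mp1(2)[of d] my[of d] y by auto
    next
      fix d show "(?m d = 0) = (d < k)" using mp1(3)[of d] j kc by auto
    next
      fix d assume "Suc M \<le> d" then show "?m d = j" using c by auto
    next
      fix d assume d: "k \<le> d \<and> d < Suc M"
      show "cnt ?v (Suc d) (?m d) = cnt ?v d (?m d)"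
      proof (cases "Suc c \<le> d")
        case True then show ?thesis using tight[of d] d by simp
      next
        case False
        then have p: "0 < m d" using mp1(3)[of d] d by auto
        show ?thesis using mp1(5)[of d] d False my[of d] unfolding cS[OF p] by (auto simp: y_def)
      qed
    next
      fix d x assume x: "?m d < x \<and> x \<le> ?m (Suc d)"
      then have p: "0 < x" by simp
      consider "d = c" | "d < c" using x by (cases "Suc c \<le> d") force+
      then show "cnt ?v (Suc d) x < cnt ?v d x"
      proof cases
        case 1
        \<comment> \<open>Thresholds up to \<open>y\<close> are covered by the recursive path; those
          between \<open>y\<close> and \<open>j\<close> by row \<open>r\<close>, which drops from at
          least \<open>j\<close> to \<open>y\<close>.\<close>
        show ?thesis
        proof (cases "x \<le> y")
          case True
          then show ?thesis using mp1(6)[of d x] x 1 mp1(4)[of "Suc c"] unfolding cS[OF p] by (auto simp: y_def)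
        next
          case False
          then show ?thesis using cnt_less_iff[OF p, of c] x 1 lo by (auto simp: y_def intro!: exI[of _ r])
        qed
      next
        case 2
        then show ?thesis using mp1(6)[of d x] x unfolding cS[OF p] by auto
      qed
    qed
    have C': "shift (cnt (entry i ?S)) m d x = shift (cnt ?v) ?m d x" if "0 < x" for d x
    proof -
      consider "d < Suc c" | "d = Suc c" | "Suc c < d" by linarith
      then show ?thesis
      proof cases
        case 1 then show ?thesis unfolding shift_def cS[OF that] by auto
      next
        case 2 then show ?thesis unfolding shift_def cS[OF that] using my[of c] mp1(4)[of "Suc c"] y by (auto simp: y_def)
      next
        case 3
        then have "Suc c \<le> d - 1" by simp
        then show ?thesis using 3 mp1(4) unfolding shift_def cS[OF that] by auto
      qed
    qed
    have W': "wt ?S l + (if l = y then 1 else 0) = wt S l + (if l = j then 1 else 0)" for l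
      by (rule wt_replace[OF finite_dom_key_filling[OF less.prems(1)] y(3)])
    have eq: "flagged_insert_loop i (enat (Suc M)) S j = flagged_insert_loop i (enat (Suc c)) ?S y"
      using step y(3) by simp
    show ?thesis
      unfolding eq
    proof (intro exI conjI allI impI)
      show "cnt (entry i (flagged_insert_loop i (enat (Suc c)) ?S y)) d x = shift (cnt ?v) ?m d x" if "0 < x" for d x
        using C[OF that] C'[OF that] by simp
      show "wt (flagged_insert_loop i (enat (Suc c)) ?S y) l = wt S l + (if l = j then 1 else 0)" for l
        using W[of l] W'[of l] by simp
    qed (use IH P in blast)+
  qed
qed

text \<open>The same invariants run backwards: \<open>y\<close> is an entry that was removed from a column, and the
  entry that displaced it is searched for in the columns to the right.\<close>

lemma flagged_insert_loop_preimage: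
  assumes "key_filling_of i a S" "y \<in> {1..i}" "\<And>q. entry i S (Suc c) q \<noteq> y"
    and "\<And>r q. \<lbrakk>entry i S (Suc (Suc c)) r \<le> y; y < entry i S (Suc c) r; r < q; y \<le> entry i S c q\<rbrakk>
      \<Longrightarrow> y \<le> entry i S (Suc c) q"
  shows "\<exists>S' j. key_filling_of i a S' \<and> j \<in> {1..i} \<and>
    flagged_insert i S' j = flagged_insert_loop i (enat (Suc c)) S y"
  using assms
\<comment> \<open>Entries grow along the reverse route but never exceed \<open>i\<close>.\<close>
proof (induction "i - y" arbitrary: S y c rule: less_induct)
  case (less y S c)
  let ?v = "entry i S"
  note kd = key_filling_ofD[OF less.prems(1)]
  interpret key_filling i a ?v by (rule kd(1))
  have y: "0 < y" using less.prems(2) by simp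
  \<comment> \<open>As long as no reverse bump is possible, \<open>y\<close> stays absent from the
    columns passed and forward insertion finds no place for it there, so the forward loop runs
    through them without stopping.\<close>
  have adv: "(\<forall>q. ?v (Suc d) q \<noteq> y) \<and> (\<forall>r. y \<le> ?v d r \<longrightarrow> y \<le> ?v (Suc d) r)"
    if "Suc c \<le> d" "\<And>e. Suc c \<le> e \<Longrightarrow> e \<le> d \<Longrightarrow> \<forall>r. y < ?v e r \<longrightarrow> y < ?v (Suc e) r" for d
    using that
  proof (induction d rule: dec_induct)
    case base
    have h: "y < ?v (Suc (Suc c)) r" if "y < ?v (Suc c) r" for r using base(1)[of "Suc c"] that by simp
    have "?v (Suc (Suc c)) q \<noteq> y" for q
      using h[of q] dec[of "Suc c" q] less.prems(3)[of q] by force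
    moreover have "y \<le> ?v (Suc (Suc c)) r" if "y \<le> ?v (Suc c) r" for r
      using h[of r] less.prems(3)[of r] that by force
    ultimately show ?case by blast
  next
    case (step d)
    then have o: "\<And>q. ?v (Suc d) q \<noteq> y" by simp
    have h: "y < ?v (Suc (Suc d)) r" if "y < ?v (Suc d) r" for r using step(4)[of "Suc d"] step(1) that by simp
    have "?v (Suc (Suc d)) q \<noteq> y" for q
      using h[of q] dec[of "Suc d" q] o[of q] by force
    moreover have "y \<le> ?v (Suc (Suc d)) r" if "y \<le> ?v (Suc d) r" for r
      using h[of r] o[of r] that by force
    ultimately show ?case by blast
  qed
  show ?case
  proof (cases "\<exists>e\<ge>Suc c. \<exists>r. y < ?v e r \<and> ?v (Suc e) r \<le> y")
    \<comment> \<open>Nothing can be displaced any more: \<open>y\<close> is the letter sought and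
      \<open>S\<close> is its own preimage.\<close>
    case False
    then have "\<And>e. Suc c \<le> e \<Longrightarrow> \<forall>r. y < ?v e r \<longrightarrow> y < ?v (Suc e) r" by (meson not_le)
    then have t: "\<And>d r. Suc c \<le> d \<Longrightarrow> y \<le> ?v d r \<Longrightarrow> y \<le> ?v (Suc d) r" using adv by blast
    have "flagged_insert i S y = flagged_insert_loop i (enat (Suc c)) S y"
      unfolding flagged_insert_def by (rule loop_bound[OF kd(1) y _ t]) auto
    then show ?thesis using less.prems by blast
  next
    case True
    define P where "P e \<longleftrightarrow> Suc c \<le> e \<and> (\<exists>r. y < ?v e r \<and> ?v (Suc e) r \<le> y)" for e
    define e0 where "e0 = (LEAST e. P e)"
    have Pe: "P e0" unfolding e0_def by (rule LeastI_ex) (use True P_def in blast)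
    have least: "\<forall>r. y < ?v e r \<longrightarrow> y < ?v (Suc e) r" if "Suc c \<le> e" "e < e0" for e
    proof -
      have "\<not> P e" using that(2) unfolding e0_def by (rule not_less_Least)
      then show ?thesis using that(1) unfolding P_def by (meson not_le)
    qed
    obtain b where b: "e0 = Suc b" using Pe unfolding P_def by (cases e0) auto
    have cb: "c \<le> b" using Pe b unfolding P_def by simp
    let ?R = "{r. y < ?v (Suc b) r \<and> ?v (Suc (Suc b)) r \<le> y}"
    have finR: "finite ?R" by (rule finite_subset[OF _ fin[OF y, of "Suc b"]]) auto
    define r where "r = Min ?R"
    have rR: "r \<in> ?R" unfolding r_def by (rule Min_in[OF finR]) (use Pe b P_def in auto)
    have g: "y < ?v (Suc b) r" and h: "?v (Suc (Suc b)) r \<le> y" using rR by auto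
    have tt: "(\<forall>q. ?v (Suc d) q \<noteq> y) \<and> (\<forall>r. y \<le> ?v d r \<longrightarrow> y \<le> ?v (Suc d) r)"
      if "Suc c \<le> d" "d < Suc b" for d by (rule adv[OF that(1)]) (use least b that in auto)
    have new: "?v (Suc b) q \<noteq> y" for q
      using less.prems(3)[of q] tt[of b] cb by (cases "b = c") auto
    have f: "fits ?v b r y"
      unfolding fits_def
    proof (intro conjI allI impI)
      fix q assume q: "r < q" "y \<le> ?v b q"
      show "y \<le> ?v (Suc b) q"
      proof (cases "b = c")
        case True then show ?thesis using less.prems(4)[of r q] g h q by simp
      next
        case False then show ?thesis using tt[of b] cb q by auto
      qed
    next
      fix q assume q: "q < r" "y < ?v (Suc b) q"
      show "y < ?v (Suc (Suc b)) q"
      proof (rule ccontr)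
        assume "\<not> ?thesis"
        then have "q \<in> ?R" using q by simp
        then have "r \<le> q" unfolding r_def by (rule Min_le[OF finR])
        then show False using q by simp
      qed
    qed
    define x where "x = ?v (Suc b) r"
    have x: "y < x" "0 < x" "S (Suc b, r) = Some x" using g kd(4)[of b r] by (auto simp: x_def)
    have lo: "y \<le> ?v b r" using g dec[of b r] by simp
    let ?S = "S((Suc b, r) \<mapsto> y)"
    have vS: "entry i ?S = put ?v (Suc b) r y" by (rule entry_upd)
    have kf: "key_filling i a (entry i ?S)"
      unfolding vS by (rule replace_entry[OF f h lo _ y new]) (use g in simp)
    have dm: "dom ?S = key_diagram a" using kd(2) x by auto
    have kfo: "key_filling_of i a ?S" unfolding key_filling_of_def using kf dm by simp
    have fx: "fits ?v b r x" unfolding x_def by (rule fits_old_entry[OF f h lo _ y]) (use g in simp)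
    have xi: "x \<in> {1..i}" using x le_i[of "Suc b" r] by (auto simp: x_def)
    have xnew: "entry i ?S (Suc b) q \<noteq> x" for q
      unfolding vS using x inj[of "Suc b" r q] by (auto simp: put_apply x_def)
    have inv': "x \<le> entry i ?S (Suc b) q"
      if h': "entry i ?S (Suc (Suc b)) r' \<le> x" "x < entry i ?S (Suc b) r'" "r' < q" "x \<le> entry i ?S b q" for r' q
    proof -
      have "r' \<noteq> r" using h'(2) x by (auto simp: vS put_apply)
      then have "\<not> r' < r" using fx h'(1,2) unfolding fits_def by (auto simp: vS put_apply)
      then have "r < q" using h' \<open>r' \<noteq> r\<close> by simp
      then show ?thesis using fx h'(4) unfolding fits_def by (auto simp: vS put_apply)
    qed
    have "i - x < i - y" using x xi by auto
    then have "\<exists>S' j. key_filling_of i a S' \<and> j \<in> {1..i} \<and>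
      flagged_insert i S' j = flagged_insert_loop i (enat (Suc b)) ?S x"
      by (rule less.hyps[OF _ kfo xi xnew]) (rule inv')
    then obtain S' j where
      S': "key_filling_of i a S'" "j \<in> {1..i}" "flagged_insert i S' j = flagged_insert_loop i (enat (Suc b)) ?S x"
      by blast
    \<comment> \<open>Run forwards, \<open>x\<close> returns to the row it was taken from and
      removes \<open>y\<close> again, which restores \<open>S\<close> with \<open>y\<close> in
      hand.\<close>
    have "flagged_insert_loop i (enat (Suc b)) ?S x =
      (case ?S (Suc b, r) of None \<Rightarrow> ?S((Suc b, r) \<mapsto> x)
       | Some j' \<Rightarrow> flagged_insert_loop i (enat (Suc b)) (?S((Suc b, r) \<mapsto> x)) j')"
    proof (rule loop_step[OF kf x(2)])
      show "x \<le> entry i ?S b r" using dec[of b r] by (auto simp: vS put_apply x_def)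
      show "entry i ?S (Suc b) r < x" using x by (simp add: vS put_apply)
      show "x \<le> entry i ?S (Suc b) q" if "r < q" "x \<le> entry i ?S b q" for q
        using fx that unfolding fits_def by (auto simp: vS put_apply)
    qed auto
    also have "?S((Suc b, r) \<mapsto> x) = S" using x(3) by auto
    also have "(case ?S (Suc b, r) of None \<Rightarrow> S
       | Some j' \<Rightarrow> flagged_insert_loop i (enat (Suc b)) S j') = flagged_insert_loop i (enat (Suc b)) S y"
      by simp
    also have "\<dots> = flagged_insert_loop i (enat (Suc c)) S y"
      by (rule loop_bound[OF kd(1) y]) (use cb tt in auto)
    finally show ?thesis using S' by metis
  qed
qed

lemma empty_columns:
  assumes "key_filling i a v"
  shows "\<exists>M. \<forall>c\<ge>M. \<forall>r. v c r = 0"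
proof (intro exI allI impI)
  fix c r assume c: "Suc (sum a {1..i}) \<le> c"
  show "v c r = 0"
  proof (rule ccontr)
    assume "v c r \<noteq> 0"
    then have "r \<in> {1..i}" "c \<le> a r" using key_filling.pos[OF assms, of c r] by auto
    then show False using member_le_sum[of r "{1..i}" a] c by auto
  qed
qed

text \<open>Starting to the right of all cells makes the invariant of the loop vacuous, because the
  columns there are empty.\<close>

lemma flagged_insert_key_filling:
  assumes kf: "key_filling_of i a S" and j: "j \<in> {1..i}"
  shows "\<exists>r m k N. key_filling_of i (a(r := k)) (flagged_insert i S j) \<and>
    r \<in> {1..i} \<and> Suc (a r) = k \<and> (\<forall>q. r < q \<and> q \<le> i \<longrightarrow> a q \<noteq> a r) \<and>
    bump_path N (cnt (entry i S)) j m k \<and> (\<forall>d\<ge>N. \<forall>x>0. cnt (entry i S) d x = 0) \<and>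
    (\<forall>d x. 0 < x \<longrightarrow> cnt (entry i (flagged_insert i S j)) d x = shift (cnt (entry i S)) m d x) \<and>
    (\<forall>l. wt (flagged_insert i S j) l = wt S l + (if l = j then 1 else 0))"
proof -
  note kd = key_filling_ofD[OF kf]
  obtain M where M: "\<And>c r. M \<le> c \<Longrightarrow> entry i S c r = 0" using empty_columns[OF kd(1)] by blast
  have eq: "flagged_insert i S j = flagged_insert_loop i (enat (Suc M)) S j"
    unfolding flagged_insert_def by (rule loop_bound[OF kd(1)]) (use j M in auto)
  have "\<And>q. entry i S (Suc M) q \<noteq> j" using M j by auto
  from flagged_insert_loop_key_filling[OF kf j this] obtain r m k where
    "key_filling_of i (a(r := k)) (flagged_insert_loop i (enat (Suc M)) S j) \<and>
    r \<in> {1..i} \<and> Suc (a r) = k \<and> (\<forall>q. r < q \<and> q \<le> i \<longrightarrow> a q \<noteq> a r) \<and>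
    bump_path (Suc M) (cnt (entry i S)) j m k \<and>
    (\<forall>d x. 0 < x \<longrightarrow> cnt (entry i (flagged_insert_loop i (enat (Suc M)) S j)) d x = shift (cnt (entry i S)) m d x) \<and>
    (\<forall>l. wt (flagged_insert_loop i (enat (Suc M)) S j) l = wt S l + (if l = j then 1 else 0))"
    using M j by auto
  moreover have "\<forall>d\<ge>Suc M. \<forall>x>0. cnt (entry i S) d x = 0" using M by (auto simp: cnt_def)
  ultimately show ?thesis unfolding eq by blast
qed

text \<open>With the end cell of row \<open>r\<close> emptied, the loop holding its entry would
  refill that very cell as its last bump. The reverse route from this state yields the original
  filling and letter.\<close>

lemma flagged_insert_preimage:
  assumes kf: "key_filling_of i a S" and ar: "a r = Suc c"
    and top: "\<And>q. r < q \<Longrightarrow> q \<le> i \<Longrightarrow> a q \<noteq> c"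
  shows "\<exists>S' j. key_filling_of i (a(r := c)) S' \<and> j \<in> {1..i} \<and> flagged_insert i S' j = S"
proof -
  note kd = key_filling_ofD[OF kf]
  interpret key_filling i a "entry i S" by (rule kd(1))
  let ?v = "entry i S"
  define y where "y = ?v (Suc c) r"
  let ?S = "S((Suc c, r) := None)"
  have vS: "entry i ?S = put ?v (Suc c) r 0" by (rule entry_del)
  have ri: "r \<in> {1..i}" using supp ar by fastforce
  have y: "0 < y" using pos[of "Suc c" r] ri ar by (auto simp: y_def)
  have Sy: "S (Suc c, r) = Some y" using kd(4)[of c r] y by (simp add: y_def)
  have yi: "y \<in> {1..i}" using y le_i[of "Suc c" r] by (auto simp: y_def)
  note rm = remove_entry[OF ar top]
  have kfo: "key_filling_of i (a(r := c)) ?S"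
    unfolding key_filling_of_def vS using rm(1) kd(2) ar by (auto simp: key_diagram_def)
  have f: "fits (entry i ?S) c r y" unfolding vS y_def by (rule rm(2))
  have new: "entry i ?S (Suc c) q \<noteq> y" for q
    unfolding vS using y inj[of "Suc c" r q] by (auto simp: put_apply y_def)
  have inv: "y \<le> entry i ?S (Suc c) q"
    if h: "entry i ?S (Suc (Suc c)) r' \<le> y" "y < entry i ?S (Suc c) r'" "r' < q" "y \<le> entry i ?S c q" for r' q
  proof -
    have "r' \<noteq> r" using h(2) by (auto simp: vS put_apply)
    then have "r < r'" using rm(3)[of r'] h(1,2) by (auto simp: vS put_apply y_def)
    then have "r < q" using h by simp
    then show ?thesis using f h(4) unfolding fits_def by simp
  qed
  have "\<exists>S' j. key_filling_of i (a(r := c)) S' \<and> j \<in> {1..i} \<and>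
      flagged_insert i S' j = flagged_insert_loop i (enat (Suc c)) ?S y"
    by (rule flagged_insert_loop_preimage[OF kfo yi new]) (rule inv)
  then obtain S' j where
    S': "key_filling_of i (a(r := c)) S'" "j \<in> {1..i}"
      "flagged_insert i S' j = flagged_insert_loop i (enat (Suc c)) ?S y" by blast
  have "flagged_insert_loop i (enat (Suc c)) ?S y =
    (case ?S (Suc c, r) of None \<Rightarrow> ?S((Suc c, r) \<mapsto> y)
     | Some j' \<Rightarrow> flagged_insert_loop i (enat (Suc c)) (?S((Suc c, r) \<mapsto> y)) j')"
  proof (rule loop_step[OF _ y])
    show "key_filling i (a(r := c)) (entry i ?S)" using kfo unfolding key_filling_of_def by simp
    show "y \<le> entry i ?S c r" using dec[of c r] by (auto simp: vS put_apply y_def)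
    show "entry i ?S (Suc c) r < y" using y by (simp add: vS put_apply)
    show "y \<le> entry i ?S (Suc c) q" if "r < q" "y \<le> entry i ?S c q" for q
      using f that unfolding fits_def by auto
  qed auto
  also have "\<dots> = S" using Sy by (auto simp: fun_upd_idem)
  finally show ?thesis using S' by metis
qed

section \<open>Bumping routes on column counts\<close>

text \<open>Rows are forgotten here. What remains of column injectivity is \<open>drop\<close>: a
  column contains no number twice. No basement is fixed in column \<open>0\<close>.\<close>

locale column_counts =
  fixes N :: nat and F :: "nat \<Rightarrow> nat \<Rightarrow> nat"
  assumes anti: "0 < x \<Longrightarrow> F (Suc c) x \<le> F c x"
    and anti_entry: "0 < x \<Longrightarrow> F c (Suc x) \<le> F c x"
    and drop: "0 < x \<Longrightarrow> F c x \<le> Suc (F c (Suc x))"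
    and zero: "N \<le> c \<Longrightarrow> 0 < x \<Longrightarrow> F c x = 0"
begin

lemma path_tight:
  assumes "bump_path N F j m k" "k \<le> d"
  shows "F (Suc d) (m d) = F d (m d)"
proof -
  have "0 < m d" using assms unfolding bump_path_def by (metis not_le gr0I)
  then show ?thesis using assms zero[of d "m d"] zero[of "Suc d" "m d"] unfolding bump_path_def by (cases "d < N") auto
qed

text \<open>This encodes that column \<open>d\<close> does not contain the arriving entry
  \<open>m d\<close>. Going left from the empty columns, there are two cases: if column
  \<open>e + 1\<close> keeps the same value, absence passes through the tight step; otherwise the
  strict drop at \<open>m e + 1\<close> compensates for the one occurrence that \<open>drop\<close>
  allows in column \<open>e + 1\<close>.\<close>

lemma path_absent:
  assumes p: "bump_path N F j m k" and d: "k \<le> d"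
  shows "F d (Suc (m d)) = F d (m d)"
proof -
  have pos: "0 < m e" if "k \<le> e" for e using p that unfolding bump_path_def by (metis not_le gr0I)
  show ?thesis
  proof (cases "N \<le> d")
    case True then show ?thesis using zero pos[OF d] by simp
  next
    case False
    then have "d \<le> N" by simp
    then show ?thesis using d
    proof (induction d rule: inc_induct)
      case base then show ?case using zero pos by simp
    next
      case (step e)
      let ?x = "m e"
      have x: "0 < ?x" using pos step by simp
      have t: "F (Suc e) ?x = F e ?x" using path_tight[OF p] step by simp
      have "F e ?x \<le> F e (Suc ?x)"
      proof (cases "m (Suc e) = ?x")
        case True
        then show ?thesis using step t anti[of "Suc ?x" e] by simp
      next
        case False
        then have "?x < Suc ?x \<and> Suc ?x \<le> m (Suc e)" using p unfolding bump_path_def by (simp add: Suc_le_eq le_neq_implies_less)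
        then have "F (Suc e) (Suc ?x) < F e (Suc ?x)" using p unfolding bump_path_def by blast
        then show ?thesis using drop[OF x, of "Suc e"] t by simp
      qed
      then show ?case using anti_entry[OF x, of e] by simp
    qed
  qed
qed

lemma shift_tight:
  assumes p: "bump_path N F j m k" and d: "k \<le> d"
  shows "shift F m (Suc d) (Suc (m d)) = shift F m d (Suc (m d))"
proof -
  let ?x = "m d"
  have x: "0 < ?x" using p d unfolding bump_path_def by (metis not_le gr0I)
  have t: "F (Suc d) ?x = F d ?x" "F d (Suc ?x) = F d ?x" using path_tight[OF p d] path_absent[OF p d] by auto
  show ?thesis
  proof (cases "m (Suc d) = ?x")
    case True
    then show ?thesis using path_absent[OF p, of "Suc d"] d t by (simp add: shift_def)
  next
    case False
    then have l: "Suc ?x \<le> m (Suc d)" using p unfolding bump_path_def by (simp add: Suc_le_eq le_neq_implies_less)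
    then have "F (Suc d) (Suc ?x) < F d (Suc ?x)" using p unfolding bump_path_def by blast
    then show ?thesis using drop[OF x, of "Suc d"] t l by (simp add: shift_def)
  qed
qed

lemma shift_less:
  assumes "m (d - 1) < x" "x \<le> m d"
  shows "shift F m (Suc d) x < shift F m d x"
  using assms anti[of x d] by (simp add: shift_def)

end

text \<open>By \<open>shift_tight\<close> and \<open>shift_less\<close>, \<open>m d + 1\<close> is the least \<open>x > m (d - 1)\<close> at which the new counts of
  the columns \<open>d\<close> and \<open>d + 1\<close> agree.\<close>

lemma path_unique_le:
  assumes F: "column_counts N F" and G: "column_counts N' G"
    and p: "bump_path N F j m k" and q: "bump_path N' G j' m' k"
    and eq: "\<And>d x. 1 \<le> d \<Longrightarrow> 0 < x \<Longrightarrow> shift F m d x = shift G m' d x"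
    and d: "k \<le> d" and prev: "m (d - 1) = m' (d - 1)"
  shows "m' d \<le> m d"
proof (rule ccontr)
  assume n: "\<not> m' d \<le> m d"
  have d1: "1 \<le> d" using d p unfolding bump_path_def by simp
  have "m (d - 1) \<le> m d" using p d1 unfolding bump_path_def by (metis Suc_pred' less_eq_Suc_le One_nat_def)
  then have "shift G m' (Suc d) (Suc (m d)) < shift G m' d (Suc (m d))"
    by (intro column_counts.shift_less[OF G]) (use n prev in auto)
  then show False using column_counts.shift_tight[OF F p d] eq[of d "Suc (m d)"] eq[of "Suc d" "Suc (m d)"] d1 by simp
qed

text \<open>The values are recovered from left to right, starting with \<open>0\<close> to the left
  of column \<open>k\<close>; the letter is the eventual value. Column \<open>0\<close> is excluded
  so that the size of the basement does not matter.\<close>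

lemma path_unique:
  assumes F: "column_counts N F" and G: "column_counts N' G"
    and p: "bump_path N F j m k" and q: "bump_path N' G j' m' k"
    and eq: "\<And>d x. 1 \<le> d \<Longrightarrow> 0 < x \<Longrightarrow> shift F m d x = shift G m' d x"
  shows "m = m'" and "j = j'" and "\<And>d x. 1 \<le> d \<Longrightarrow> 0 < x \<Longrightarrow> F d x = G d x"
proof -
  have "m d = m' d" for d
  proof (induction d rule: less_induct)
    case (less d)
    show ?case
    proof (cases "d < k")
      case True
      then show ?thesis using p q unfolding bump_path_def by metis
    next
      case False
      then have k: "k \<le> d" "1 \<le> d" using p unfolding bump_path_def by auto
      then have prev: "m (d - 1) = m' (d - 1)" by (intro less) simp
      show ?thesis
        using path_unique_le[OF F G p q eq k(1) prev] path_unique_le[OF G F q p eq[symmetric] k(1) prev[symmetric]]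
        by simp
    qed
  qed
  then show m: "m = m'" by blast
  have "m (max N N') = j" "m' (max N N') = j'" using p q unfolding bump_path_def by auto
  then show "j = j'" using m by simp
  show "F d x = G d x" if "1 \<le> d" "0 < x" for d x using eq[OF that] m by (simp add: shift_def)
qed

text \<open>The second route stays one column behind: \<open>m' c \<le> m (c - 1)\<close>. If this
  failed while holding one column to the right, then the counts between the two insertions would
  drop strictly at the threshold \<open>m' c\<close>, where the second route needs them equal. At
  \<open>c = k\<close> the bound is \<open>0\<close>, so the second route has already ended.\<close>

lemma path_column_less:
  assumes F: "column_counts N F" and F': "column_counts N' F'"
    and p: "bump_path N F j m k" and q: "bump_path N' F' j' m' k'"
    and eq: "\<And>d x. 0 < x \<Longrightarrow> F' d x = shift F m d x" and le: "j' \<le> j"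
  shows "k < k'"
proof -
  have "m' c \<le> m (c - 1)" if "1 \<le> c" for c
  proof (cases "N + N' + 1 \<le> c")
    case True
    then show ?thesis using p q le unfolding bump_path_def by simp
  next
    case False
    then have "c \<le> N + N' + 1" by simp
    then show ?thesis using that
    proof (induction c rule: inc_induct)
      case base
      then show ?case using p q le unfolding bump_path_def by simp
    next
      case (step c)
      then have IH: "m' (Suc c) \<le> m c" by simp
      show ?case
      proof (rule ccontr)
        assume n: "\<not> ?case"
        let ?x = "m' c"
        have x: "0 < ?x" using n by simp
        have kc: "k' \<le> c"
        proof (rule ccontr)
          assume "\<not> k' \<le> c"
          then have "m' c = 0" using q unfolding bump_path_def by simp
          then show False using x by simp
        qed
        have t: "F' (Suc c) ?x = F' c ?x" by (rule column_counts.path_tight[OF F' q kc])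
        have "?x \<le> m c" using IH q unfolding bump_path_def by (meson order_trans)
        then have "shift F m (Suc c) ?x < shift F m c ?x"
          by (intro column_counts.shift_less[OF F]) (use n in auto)
        then show False using t eq[OF x] by simp
      qed
    qed
  qed
  then have "m' k \<le> m (k - 1)" "1 \<le> k" using p unfolding bump_path_def by auto
  moreover have "m (k - 1) = 0" using p unfolding bump_path_def by auto
  ultimately have "m' k = 0" by simp
  then show ?thesis using q unfolding bump_path_def by blast
qed

text \<open>Here \<open>m c < m' c\<close> holds without a shift of columns: by
  \<open>shift_tight\<close> the intermediate counts agree at \<open>m c + 1\<close>, so the second
  route cannot fall to \<open>m c\<close> or below there. Hence it is still alive in column
  \<open>k\<close>.\<close>

lemma path_column_le:
  assumes F: "column_counts N F"
    and p: "bump_path N F j m k" and q: "bump_path N' F' j' m' k'"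
    and eq: "\<And>d x. 0 < x \<Longrightarrow> F' d x = shift F m d x" and less: "j < j'"
  shows "k' \<le> k"
proof -
  have "m c < m' c" if "k \<le> c" for c
  proof (cases "N + N' \<le> c")
    case True
    then show ?thesis using p q less unfolding bump_path_def by simp
  next
    case False
    then have "c \<le> N + N'" by simp
    then show ?thesis using that
    proof (induction c rule: inc_induct)
      case base
      then show ?case using p q less unfolding bump_path_def by simp
    next
      case (step c)
      then have "m (Suc c) < m' (Suc c)" by simp
      moreover have "m c \<le> m (Suc c)" using p unfolding bump_path_def by blast
      ultimately have l: "Suc (m c) \<le> m' (Suc c)" by simp
      have t: "F' (Suc c) (Suc (m c)) = F' c (Suc (m c))"
        using column_counts.shift_tight[OF F p step(4)] eq by simp
      show ?case
      proof (rule ccontr)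
        assume "\<not> ?case"
        then have "m' c < Suc (m c)" by simp
        then have "F' (Suc c) (Suc (m c)) < F' c (Suc (m c))" using l q unfolding bump_path_def by blast
        then show False using t by simp
      qed
    qed
  qed
  then have "m' k \<noteq> 0" by fastforce
  then show ?thesis using q unfolding bump_path_def by (meson not_le)
qed

lemma (in key_filling) column_counts_cnt:
  assumes "\<And>d x. N \<le> d \<Longrightarrow> 0 < x \<Longrightarrow> cnt v d x = 0"
  shows "column_counts N (cnt v)"
  by unfold_locales (auto simp: cnt_Suc_le cnt_Suc_t_le cnt_step assms)

section \<open>Recording fillings\<close>

text \<open>Increasing rows leave only one of the three inversion orders possible; as for key
  fillings, the attacking pairs in adjacent columns are absorbed into the triple conditions.
  \<open>inc\<close> is restricted to filled cells because empty ones have entry \<open>0\<close>,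
  and \<open>le_i\<close> must be assumed because the basement bounds increasing rows only from
  below.\<close>

locale atom_filling =
  fixes i :: nat and a :: "nat \<Rightarrow> nat" and w :: "nat \<Rightarrow> nat \<Rightarrow> nat"
  assumes supp: "r \<notin> {1..i} \<Longrightarrow> a r = 0"
    and pos: "0 < w c r \<longleftrightarrow> r \<in> {1..i} \<and> c \<le> a r"
    and base: "r \<in> {1..i} \<Longrightarrow> w 0 r = r"
    and le_i: "w c r \<le> i"
    and inc: "Suc c \<le> a r \<Longrightarrow> w c r \<le> w (Suc c) r"
    and inj: "w c r = w c s \<Longrightarrow> 0 < w c r \<Longrightarrow> r = s"
    and tripA: "r < s \<Longrightarrow> a s < a r \<Longrightarrow> 0 < w c s \<Longrightarrow> w c r < w c s \<Longrightarrow> w (Suc c) r < w c s"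
    and tripB: "r < s \<Longrightarrow> a r \<le> a s \<Longrightarrow> 0 < w (Suc c) r \<Longrightarrow> w c s \<le> w (Suc c) r
      \<Longrightarrow> w (Suc c) s \<le> w (Suc c) r"
begin

text \<open>The basement puts the longer lower row below the upper one; alternating
  \<open>tripA\<close> and \<open>inc\<close> keeps it smaller even when it is read one column
  ahead.\<close>

lemma no_crossing:
  assumes "q < r" "a r < a q" "q \<in> {1..i}" "r \<in> {1..i}" "d \<le> a r"
  shows "w (Suc d) q < w d r"
  using assms(5)
proof (induction d)
  case 0
  have "w 0 q < w 0 r" using base assms by simp
  then show ?case using tripA[OF assms(1,2), of 0] by simp
next
  case (Suc d)
  then have "w (Suc d) q < w (Suc d) r" using inc[of d r] by simp
  then show ?case using tripA[OF assms(1,2), of "Suc d"] by simp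
qed

text \<open>At the new cell most inequalities are instances of \<open>le_i\<close>, and
  \<open>new\<close> supplies strictness where it is required. Lower rows of length
  \<open>c + 1\<close> move to \<open>tripB\<close>, whose hypothesis is refuted by
  \<open>no_crossing\<close>.\<close>

lemma add_max:
  assumes r: "r \<in> {1..i}" and ar: "a r = c" and top: "\<And>q. r < q \<Longrightarrow> q \<le> i \<Longrightarrow> a q \<noteq> c"
    and new: "\<And>d q. c < d \<Longrightarrow> w d q \<noteq> i"
  shows "atom_filling i (a(r := Suc c)) (put w (Suc c) r i)"
proof -
  let ?w = "put w (Suc c) r i"
  let ?a = "a(r := Suc c)"
  have i: "0 < i" using r by simp
  have pt: "q \<in> {1..i}" "d \<le> a q" if "0 < w d q" for d q using that pos by blast+
  have zero: "w d r = 0" if "c < d" for d using pos[of d r] ar that by auto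
  show ?thesis
  proof
    fix q assume "q \<notin> {1..i}" then show "?a q = 0" using supp r by auto
  next
    fix d q show "0 < ?w d q \<longleftrightarrow> q \<in> {1..i} \<and> d \<le> ?a q"
      using pos[of d q] i r ar by (auto simp: put_apply)
  next
    fix q assume "q \<in> {1..i}" then show "?w 0 q = q" using base by (simp add: put_apply)
  next
    fix d q show "?w d q \<le> i" using le_i by (simp add: put_apply)
  next
    fix d q assume "Suc d \<le> ?a q" then show "?w d q \<le> ?w (Suc d) q"
      using inc[of d q] le_i[of c r] ar by (auto simp: put_apply split: if_splits)
  next
    fix d q s assume "?w d q = ?w d s" "0 < ?w d q"
    then show "q = s" using inj[of d q s] new[of "Suc c" s] new[of "Suc c" q] by (auto simp: put_apply split: if_splits)
  next
    fix r' s d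
    assume rs: "r' < s" and as: "?a s < ?a r'" and ps: "0 < ?w d s" and le: "?w d r' < ?w d s"
    consider (r) "r' = r" | (s) "s = r" | (o) "r' \<noteq> r" "s \<noteq> r" by blast
    then show "?w (Suc d) r' < ?w d s"
    proof cases
      case r
      have ps': "0 < w d s" using ps rs r by (auto simp: put_apply)
      then have "a s < c" using as r rs top[of s] pt[OF ps'] by auto
      then show ?thesis using tripA[of r s d] rs r ps' le pt[OF ps'] ar by (auto simp: put_apply split: if_splits)
    next
      case s
      then have a': "Suc c < a r'" using as rs by auto
      show ?thesis
      proof (cases "d = Suc c")
        case True
        then show ?thesis using le_i[of "Suc (Suc c)" r'] new[of "Suc (Suc c)" r'] s rs
          by (auto simp: put_apply)
      next
        case False
        then show ?thesis using tripA[of r' r d] rs s a' ps le ar by (auto simp: put_apply split: if_splits)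
      qed
    next
      case o
      then show ?thesis using tripA[OF rs, of d] as ps le by (auto simp: put_apply)
    qed
  next
    fix r' s d
    assume rs: "r' < s" and as: "?a r' \<le> ?a s" and ps: "0 < ?w (Suc d) r'" and le: "?w d s \<le> ?w (Suc d) r'"
    consider (r) "r' = r" | (s) "s = r" | (o) "r' \<noteq> r" "s \<noteq> r" by blast
    then show "?w (Suc d) s \<le> ?w (Suc d) r'"
    proof cases
      case r
      then have a': "Suc c \<le> a s" using rs as by auto
      show ?thesis
      proof (cases "d = c")
        case True then show ?thesis using r rs le_i by (auto simp: put_apply)
      next
        case False then show ?thesis using r rs le tripB[of r s d] ps a' ar by (auto simp: put_apply split: if_splits)
      qed
    next
      case s
      then have a1: "a r' \<le> Suc c" using rs as by auto
      have p1: "0 < w (Suc d) r'" using ps rs s by (auto simp: put_apply)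
      note pp = pt[OF p1]
      show ?thesis
      proof (cases "a r' \<le> c")
        case True
        then show ?thesis using tripB[of r' r d] rs s p1 pp le ar by (auto simp: put_apply split: if_splits)
      next
        case False
        then have "w (Suc d) r' < w d r" using no_crossing[of r' r d] rs s ar a1 pp r by auto
        then show ?thesis using le rs s pp a1 by (auto simp: put_apply split: if_splits)
      qed
    next
      case o
      then show ?thesis using tripB[OF rs, of d] as ps le by (auto simp: put_apply)
    qed
  qed
qed

text \<open>An \<open>i\<close> in the last column containing one must end its row, since its right
  neighbour could not be smaller. A higher row of length \<open>c\<close> would need an entry above
  \<open>i\<close>, by \<open>no_crossing\<close>. Lower rows of length \<open>c + 1\<close> come
  under \<open>tripA\<close>; its conclusion is extracted from the old \<open>tripB\<close> by
  descending from column \<open>c\<close>, where \<open>i\<close> occurs only once.\<close>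

lemma remove_max:
  assumes wi: "w (Suc c) r = i" and i: "0 < i" and last: "\<And>d q. Suc c < d \<Longrightarrow> w d q \<noteq> i"
  shows "a r = Suc c" and "\<And>q. r < q \<Longrightarrow> q \<le> i \<Longrightarrow> a q \<noteq> c"
    and "atom_filling i (a(r := c)) (put w (Suc c) r 0)"
    and "\<And>d q. c < d \<Longrightarrow> put w (Suc c) r 0 d q \<noteq> i"
proof -
  have pt: "q \<in> {1..i}" "d \<le> a q" if "0 < w d q" for d q using that pos by blast+
  have r: "r \<in> {1..i}" "Suc c \<le> a r" using pt[of "Suc c" r] wi i by auto
  show ar: "a r = Suc c"
  proof (rule ccontr)
    assume "a r \<noteq> Suc c"
    then have "Suc (Suc c) \<le> a r" using r by simp
    then have "i \<le> w (Suc (Suc c)) r" using inc[of "Suc c" r] wi by simp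
    then show False using le_i[of "Suc (Suc c)" r] last[of "Suc (Suc c)" r] by simp
  qed
  show top: "a q \<noteq> c" if "r < q" "q \<le> i" for q
  proof
    assume "a q = c"
    then have "w (Suc c) r < w c q" using no_crossing[of r q c] that r ar by auto
    then show False using wi le_i[of c q] by simp
  qed
  show "put w (Suc c) r 0 d q \<noteq> i" if "c < d" for d q
    using last[of d q] that inj[of "Suc c" r q] wi i by (cases "d = Suc c") (auto simp: put_apply)
  let ?w = "put w (Suc c) r 0"
  let ?a = "a(r := c)"
  show "atom_filling i ?a ?w"
  proof
    fix q assume "q \<notin> {1..i}" then show "?a q = 0" using supp r by auto
  next
    fix d q show "0 < ?w d q \<longleftrightarrow> q \<in> {1..i} \<and> d \<le> ?a q"
      using pos[of d q] r ar by (auto simp: put_apply)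
  next
    fix q assume "q \<in> {1..i}" then show "?w 0 q = q" using base by (simp add: put_apply)
  next
    fix d q show "?w d q \<le> i" using le_i by (simp add: put_apply)
  next
    fix d q assume "Suc d \<le> ?a q" then show "?w d q \<le> ?w (Suc d) q"
      using inc[of d q] ar by (auto simp: put_apply split: if_splits)
  next
    fix d q s assume "?w d q = ?w d s" "0 < ?w d q"
    then show "q = s" using inj[of d q s] by (auto simp: put_apply split: if_splits)
  next
    fix r' s d
    assume rs: "r' < s" and as: "?a s < ?a r'" and ps: "0 < ?w d s" and le: "?w d r' < ?w d s"
    have ps': "0 < w d s" using ps by (auto simp: put_apply split: if_splits)
    note pts = pt[OF ps']
    consider (r) "r' = r" | (s) "s = r" | (o) "r' \<noteq> r" "s \<noteq> r" by blast
    then show "?w (Suc d) r' < ?w d s"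
    proof cases
      case r
      then have a': "a s < c" using as rs by auto
      then show ?thesis using tripA[of r s d] r rs ar ps' le pts by (auto simp: put_apply split: if_splits)
    next
      case s
      then have a': "c < a r'" using as rs by auto
      have "d \<noteq> Suc c" using ps s by (auto simp: put_apply)
      then have dc: "d \<le> c" using pts s ar by simp
      have r'i: "r' \<in> {1..i}" using supp a' by fastforce
      show ?thesis
      proof (cases "a r' = Suc c")
        case True
        have p: "0 < w (Suc e) r'" if "e \<le> c" for e using pos[of "Suc e" r'] r'i True that by auto
        have rr: "r' < r" using rs s by simp
        have rl: "a r' \<le> a r" using True ar by simp
        have "w (Suc d) r' < w d r"
          using dc
        proof (induction d rule: inc_induct)
          case base
          show ?case
          proof (rule ccontr)
            assume "\<not> ?case"
            then have "i \<le> w (Suc c) r'" using tripB[OF rr rl p[of c]] wi by simp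
            then have "w (Suc c) r = w (Suc c) r'" using le_i[of "Suc c" r'] wi by simp
            then show False using inj[of "Suc c" r r'] wi i rs s by auto
          qed
        next
          case (step e)
          have "w (Suc e) r' \<le> w (Suc (Suc e)) r'" by (rule inc) (use step True in simp)
          then have l: "w (Suc e) r' < w (Suc e) r" using step by simp
          show ?case
          proof (rule ccontr)
            assume "\<not> ?case"
            then have "w (Suc e) r \<le> w (Suc e) r'" using tripB[OF rr rl p[of e]] step by simp
            then show False using l by simp
          qed
        qed
        then show ?thesis using s rs dc by (auto simp: put_apply)
      next
        case False
        then show ?thesis using tripA[of r' r d] rs s a' ar ps' le dc by (auto simp: put_apply split: if_splits)
      qed
    next
      case o
      then show ?thesis using tripA[OF rs, of d] as ps le by (auto simp: put_apply)
    qed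
  next
    fix r' s d
    assume rs: "r' < s" and as: "?a r' \<le> ?a s" and ps: "0 < ?w (Suc d) r'" and le: "?w d s \<le> ?w (Suc d) r'"
    have ps': "0 < w (Suc d) r'" using ps by (auto simp: put_apply split: if_splits)
    note pts = pt[OF ps']
    consider (r) "r' = r" | (s) "s = r" | (o) "r' \<noteq> r" "s \<noteq> r" by blast
    then show "?w (Suc d) s \<le> ?w (Suc d) r'"
    proof cases
      case r
      have "d \<noteq> c" using ps r by (auto simp: put_apply)
      then have dc: "Suc d \<le> c" using pts r ar by simp
      have si: "s \<le> i"
      proof (rule ccontr)
        assume "\<not> s \<le> i"
        then have "a s = 0" using supp by auto
        then show False using as r rs dc by auto
      qed
      then have "Suc c \<le> a s" using as r rs top[of s] by auto
      then show ?thesis using tripB[of r s d] r rs ar ps' le dc by (auto simp: put_apply split: if_splits)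
    next
      case s
      then have "a r' \<le> c" using as rs by auto
      then show ?thesis using tripB[of r' r d] rs s ar ps' le pts by (auto simp: put_apply split: if_splits)
    next
      case o
      then show ?thesis using tripB[OF rs, of d] as ps le by (auto simp: put_apply)
    qed
  qed
qed

end

section \<open>Key tableaux and reverse skyline fillings\<close>

definition atom_filling_of :: "nat \<Rightarrow> (nat \<Rightarrow> nat) \<Rightarrow> filling \<Rightarrow> bool" where
  "atom_filling_of i a T \<longleftrightarrow> atom_filling i a (entry i T) \<and> dom T = key_diagram a"

lemma key_diagram_dom:
  assumes "dom T = key_diagram a"
  shows "T (Suc c, r) = None \<longleftrightarrow> a r \<le> c" and "T (0, r) = None"
proof -
  have "(x \<in> dom T) = (x \<in> key_diagram a)" for x using assms by simp
  from this[of "(Suc c, r)"] this[of "(0, r)"]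
  show "T (Suc c, r) = None \<longleftrightarrow> a r \<le> c" and "T (0, r) = None" by (auto simp: key_diagram_def)
qed

lemma hat_entry:
  assumes "T \<in> fillings n"
  shows "hat n T (c, r) = Some x \<longleftrightarrow> 0 < x \<and> entry n T c r = x"
proof -
  have "0 < y" if "hat n T (c, r) = Some y" for y
    using assms that ranI[of T "(c, r)" y] unfolding fillings_def hat_def by (force split: if_splits)
  then show ?thesis by (auto simp: entry_def split: option.splits)
qed

lemma fillingsE:
  assumes "T \<in> fillings n"
  obtains a where "\<And>r. r \<notin> {1..n} \<Longrightarrow> a r = 0" "dom T = key_diagram a" "sh T = a"
    "\<And>c r. 0 < entry n T c r \<longleftrightarrow> r \<in> {1..n} \<and> c \<le> a r" "\<And>c r. entry n T c r \<le> n"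
proof -
  obtain a where a: "a \<in> weak_compositions n" "dom T = key_diagram a" and ran: "ran T \<subseteq> {1..n}"
    using assms unfolding fillings_def by blast
  have supp: "\<And>r. r \<notin> {1..n} \<Longrightarrow> a r = 0" using a(1) by (simp add: weak_compositions_def)
  have rn: "1 \<le> x \<and> x \<le> n" if "T y = Some x" for x y using ran ranI[of T y x] that by fastforce
  have pos: "0 < entry n T c r \<longleftrightarrow> r \<in> {1..n} \<and> c \<le> a r" for c r
  proof (cases c)
    case 0 then show ?thesis by (auto simp: entry_0)
  next
    case (Suc d)
    show ?thesis
    proof (cases "T (Suc d, r)")
      case None
      then show ?thesis using key_diagram_dom(1)[OF a(2), of d r] Suc by (simp add: entry_Suc)
    next
      case (Some x)
      then have "\<not> a r \<le> d" using key_diagram_dom(1)[OF a(2), of d r] by simp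
      then show ?thesis using supp[of r] rn[OF Some] Some Suc by (force simp: entry_Suc)
    qed
  qed
  have le: "entry n T c r \<le> n" for c r using rn by (cases c) (auto simp: entry_0 entry_Suc split: option.splits)
  show thesis by (rule that[OF supp a(2) sh_eq_if_dom_eq_key_diagram[OF a(2)] pos le])
qed

lemma fillingsI:
  assumes "\<And>r. r \<notin> {1..n} \<Longrightarrow> a r = 0" "dom T = key_diagram a"
    and "\<And>c r. 0 < entry n T c r \<longleftrightarrow> r \<in> {1..n} \<and> c \<le> a r" "\<And>c r. entry n T c r \<le> n"
  shows "T \<in> fillings n"
proof -
  have "1 \<le> x \<and> x \<le> n" if "T (c, r) = Some x" for c r x
  proof -
    have "c \<noteq> 0" using key_diagram_dom(2)[OF assms(2), of r] that by (metis option.distinct(1))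
    then obtain d where c: "c = Suc d" using not0_implies_Suc by blast
    then have v: "entry n T c r = x" using that by (simp add: entry_Suc)
    have "\<not> a r \<le> d" using key_diagram_dom(1)[OF assms(2), of d r] that c by simp
    then have "0 < entry n T c r" using assms(3)[of c r] assms(1)[of r] c by fastforce
    then show ?thesis using v assms(4)[of c r] by simp
  qed
  then have "ran T \<subseteq> {1..n}" by (force simp: ran_def)
  then show ?thesis using assms(1,2) unfolding fillings_def weak_compositions_def by blast
qed

text \<open>Decreasing rows give \<open>i \<le> k\<close> in every triple, so
  \<open>i < j < k\<close> is the only co-inversion order that can occur.\<close>

lemma SSKT_iff: "S \<in> SSKT n \<longleftrightarrow> (\<exists>a. key_filling_of n a S)"
proof
  assume S: "S \<in> SSKT n"
  then have fl: "S \<in> fillings n" and na: "non_attacking (hat n S)" and rd: "rows_decreasing (hat n S)"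
    and ct: "\<And>k i j. \<not> coinversion_triple n S k i j" unfolding SSKT_def by auto
  obtain a where a: "\<And>r. r \<notin> {1..n} \<Longrightarrow> a r = 0" "dom S = key_diagram a" "sh S = a"
    "\<And>c r. 0 < entry n S c r \<longleftrightarrow> r \<in> {1..n} \<and> c \<le> a r" "\<And>c r. entry n S c r \<le> n"
    by (rule fillingsE[OF fl]) blast
  note h = hat_entry[OF fl]
  let ?v = "entry n S"
  have na': "\<not> attack (c, r) (c', r')" if "0 < ?v c r" "?v c r = ?v c' r'" for c r c' r'
    using na h[of c r "?v c r"] h[of c' r' "?v c r"] that unfolding non_attacking_def by (metis domI)
  have tr: "distinct [k, i, j] \<Longrightarrow> i < j \<Longrightarrow> j < k \<Longrightarrow> \<not> triple n S k i j" for k i j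
    using ct[of k i j] unfolding coinversion_triple_def by blast
  have "key_filling n a ?v"
  proof
    fix r assume "r \<in> {1..n}" then show "?v 0 r = r" by (simp add: entry_0)
  next
    fix c r show "?v (Suc c) r \<le> ?v c r"
    proof (cases "0 < ?v (Suc c) r")
      case True
      then have "0 < ?v c r" using a(4) by (meson Suc_leD)
      then have "hat n S (c, r) = Some (?v c r) \<and> hat n S (c + 1, r) = Some (?v (Suc c) r)" using True h by simp
      then show ?thesis using rd unfolding rows_decreasing_def by blast
    qed simp
  next
    fix c r s assume "?v c r = ?v c s" "0 < ?v c r"
    then show "r = s" using na'[of c r c s] by auto
  next
    fix r s c assume rs: "r < s" "a s < a r" "0 < ?v c s" "?v (Suc c) r \<le> ?v c s"
    have c: "c \<le> a s" using rs(3) a(4) by blast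
    have r: "r \<in> {1..n}" using a(1)[of r] rs(2) by fastforce
    have p: "0 < ?v c r" "0 < ?v (Suc c) r" using a(4) r c rs(2) by auto
    show "?v c r \<le> ?v c s"
    proof (rule ccontr)
      assume n: "\<not> ?v c r \<le> ?v c s"
      have "?v (Suc c) r \<noteq> ?v c s" using na'[of c s "Suc c" r] rs(1,3) by auto
      then have lt: "?v (Suc c) r < ?v c s" using rs(4) by simp
      have "triple n S (?v c r) (?v (Suc c) r) (?v c s)"
        unfolding triple_def a(3)
        by (intro conjI exI[of _ c] exI[of _ r] exI[of _ s] disjI1) (use h p rs n lt in auto)
      then show False using tr[of "?v c r" "?v (Suc c) r" "?v c s"] lt n by simp
    qed
  next
    fix r s c assume rs: "r < s" "a r \<le> a s" "0 < ?v (Suc c) r" "?v (Suc c) r \<le> ?v c s"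
    have c: "Suc c \<le> a r" using rs(3) a(4) by blast
    then have s: "s \<in> {1..n}" using a(1)[of s] rs(2) by fastforce
    have p: "0 < ?v c s" "0 < ?v (Suc c) s" using a(4) s c rs(2) by auto
    show "?v (Suc c) r \<le> ?v (Suc c) s"
    proof (rule ccontr)
      assume n: "\<not> ?v (Suc c) r \<le> ?v (Suc c) s"
      have "?v (Suc c) r \<noteq> ?v c s" using na'[of c s "Suc c" r] rs(1) p(1) by auto
      then have lt: "?v (Suc c) r < ?v c s" using rs(4) by simp
      have "triple n S (?v c s) (?v (Suc c) s) (?v (Suc c) r)"
        unfolding triple_def a(3)
        by (intro conjI exI[of _ c] exI[of _ r] exI[of _ s] disjI2) (use h p rs n lt in auto)
      then show False using tr[of "?v c s" "?v (Suc c) s" "?v (Suc c) r"] lt n by simp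
    qed
  qed (use a in auto)
  then show "\<exists>a. key_filling_of n a S" using a(2) unfolding key_filling_of_def by blast
next
  assume "\<exists>a. key_filling_of n a S"
  then obtain a where kf: "key_filling_of n a S" by blast
  note kd = key_filling_ofD[OF kf]
  interpret key_filling n a "entry n S" by (rule kd(1))
  let ?v = "entry n S"
  have fl: "S \<in> fillings n" by (rule fillingsI[OF supp kd(2) pos le_i])
  have sh: "sh S = a" by (rule sh_eq_if_dom_eq_key_diagram[OF kd(2)])
  note h = hat_entry[OF fl]
  have "non_attacking (hat n S)"
    unfolding non_attacking_def
  proof (intro ballI impI)
    fix x y assume xy: "x \<in> dom (hat n S)" "y \<in> dom (hat n S)" "attack x y"
    obtain c r c' r' where x: "x = (c, r)" and y: "y = (c', r')" by (cases x, cases y)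
    have px: "0 < ?v c r" "hat n S x = Some (?v c r)" using xy(1) h x by auto
    have py: "0 < ?v c' r'" "hat n S y = Some (?v c' r')" using xy(2) h y by auto
    \<comment> \<open>Equal entries in an attacking pair of adjacent columns satisfy the weak
      hypotheses of the triple conditions; with \<open>dec\<close> this forces two equal entries
      within one column.\<close>
    have ad: "?v (Suc c) r \<noteq> ?v c s" if "r < s" "0 < ?v (Suc c) r" "0 < ?v c s" for c r s
    proof
      assume e: "?v (Suc c) r = ?v c s"
      show False
      proof (cases "a s < a r")
        case True
        then have "?v c r \<le> ?v c s" using tripA[OF that(1), of c] that(3) e by simp
        then have "?v c r = ?v c s" using dec[of c r] e by simp
        then show False using inj[of c s r] that by simp
      next
        case False
        then have "?v (Suc c) r \<le> ?v (Suc c) s" using tripB[OF that(1), of c] that(2) e by simp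
        then have "?v (Suc c) r = ?v (Suc c) s" using dec[of c s] e by simp
        then show False using inj[of "Suc c" r s] that by simp
      qed
    qed
    have "?v c r \<noteq> ?v c' r'"
      using xy(3) px(1) py(1) inj[of c r r'] ad[of r' r c] ad[of r r' c'] unfolding x y by auto
    then show "hat n S x \<noteq> hat n S y" using px py by simp
  qed
  moreover have "rows_decreasing (hat n S)"
    unfolding rows_decreasing_def using h dec by auto
  moreover have "\<not> coinversion_triple n S k i j" for k i j
  proof
    assume "coinversion_triple n S k i j"
    then have t: "triple n S k i j" and o: "i < j \<and> j < k \<or> j < k \<and> k < i \<or> k < i \<and> i < j"
      unfolding coinversion_triple_def by auto
    obtain c r s where rs: "r < s" and "a s < a r \<and> ?v c r = k \<and> ?v (Suc c) r = i \<and> ?v c s = j \<and> 0 < j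
      \<or> a r \<le> a s \<and> ?v (Suc c) r = j \<and> ?v c s = k \<and> ?v (Suc c) s = i \<and> 0 < j"
      using t unfolding triple_def sh h by auto
    then show False using o dec[of c r] dec[of c s] tripA[OF rs, of c] tripB[OF rs, of c] by auto
  qed
  ultimately show "S \<in> SSKT n" using fl unfolding SSKT_def by blast
qed

lemma rSSAF_iff: "T \<in> rSSAF n \<longleftrightarrow> (\<exists>a. atom_filling_of n a T)"
proof
  assume S: "T \<in> rSSAF n"
  then have fl: "T \<in> fillings n" and na: "non_attacking (hat n T)" and rd: "rows_increasing (hat n T)"
    and ct: "\<And>k i j. \<not> inversion_triple n T k i j" unfolding rSSAF_def by auto
  obtain a where a: "\<And>r. r \<notin> {1..n} \<Longrightarrow> a r = 0" "dom T = key_diagram a" "sh T = a"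
    "\<And>c r. 0 < entry n T c r \<longleftrightarrow> r \<in> {1..n} \<and> c \<le> a r" "\<And>c r. entry n T c r \<le> n"
    by (rule fillingsE[OF fl]) blast
  note h = hat_entry[OF fl]
  let ?v = "entry n T"
  have na': "\<not> attack (c, r) (c', r')" if "0 < ?v c r" "?v c r = ?v c' r'" for c r c' r'
    using na h[of c r "?v c r"] h[of c' r' "?v c r"] that unfolding non_attacking_def by (metis domI)
  have tr: "distinct [k, i, j] \<Longrightarrow> j < i \<Longrightarrow> k < j \<Longrightarrow> \<not> triple n T k i j" for k i j
    using ct[of k i j] unfolding inversion_triple_def by blast
  have "atom_filling n a ?v"
  proof
    fix r assume "r \<in> {1..n}" then show "?v 0 r = r" by (simp add: entry_0)
  next
    fix c r assume c: "Suc c \<le> a r"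
    then have "r \<in> {1..n}" using a(1)[of r] by fastforce
    then have "0 < ?v c r" "0 < ?v (Suc c) r" using a(4) c by auto
    then have "hat n T (c, r) = Some (?v c r) \<and> hat n T (c + 1, r) = Some (?v (Suc c) r)" using h by simp
    then show "?v c r \<le> ?v (Suc c) r" using rd unfolding rows_increasing_def by blast
  next
    fix c r s assume "?v c r = ?v c s" "0 < ?v c r"
    then show "r = s" using na'[of c r c s] by auto
  next
    fix r s c assume rs: "r < s" "a s < a r" "0 < ?v c s" "?v c r < ?v c s"
    have c: "c \<le> a s" using rs(3) a(4) by blast
    have r: "r \<in> {1..n}" using a(1)[of r] rs(2) by fastforce
    have p: "0 < ?v c r" "0 < ?v (Suc c) r" using a(4) r c rs(2) by auto
    show "?v (Suc c) r < ?v c s"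
    proof (rule ccontr)
      assume n: "\<not> ?v (Suc c) r < ?v c s"
      have "?v (Suc c) r \<noteq> ?v c s" using na'[of c s "Suc c" r] rs(1,3) by auto
      then have lt: "?v c s < ?v (Suc c) r" using n by simp
      have "triple n T (?v c r) (?v (Suc c) r) (?v c s)"
        unfolding triple_def a(3)
        by (intro conjI exI[of _ c] exI[of _ r] exI[of _ s] disjI1) (use h p rs lt in auto)
      then show False using tr[of "?v c r" "?v (Suc c) r" "?v c s"] lt rs(4) by simp
    qed
  next
    fix r s c assume rs: "r < s" "a r \<le> a s" "0 < ?v (Suc c) r" "?v c s \<le> ?v (Suc c) r"
    have c: "Suc c \<le> a r" using rs(3) a(4) by blast
    then have s: "s \<in> {1..n}" using a(1)[of s] rs(2) by fastforce
    have p: "0 < ?v c s" "0 < ?v (Suc c) s" using a(4) s c rs(2) by auto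
    show "?v (Suc c) s \<le> ?v (Suc c) r"
    proof (rule ccontr)
      assume n: "\<not> ?v (Suc c) s \<le> ?v (Suc c) r"
      have "?v (Suc c) r \<noteq> ?v c s" using na'[of c s "Suc c" r] rs(1) p(1) by auto
      then have lt: "?v c s < ?v (Suc c) r" using rs(4) by simp
      have "triple n T (?v c s) (?v (Suc c) s) (?v (Suc c) r)"
        unfolding triple_def a(3)
        by (intro conjI exI[of _ c] exI[of _ r] exI[of _ s] disjI2) (use h p rs n lt in auto)
      then show False using tr[of "?v c s" "?v (Suc c) s" "?v (Suc c) r"] lt n by simp
    qed
  qed (use a in auto)
  then show "\<exists>a. atom_filling_of n a T" using a(2) unfolding atom_filling_of_def by blast
next
  assume "\<exists>a. atom_filling_of n a T"
  then obtain a where kd: "atom_filling n a (entry n T)" "dom T = key_diagram a" unfolding atom_filling_of_def by blast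
  interpret atom_filling n a "entry n T" by (rule kd(1))
  let ?v = "entry n T"
  have fl: "T \<in> fillings n" by (rule fillingsI[OF supp kd(2) pos le_i])
  have sh: "sh T = a" by (rule sh_eq_if_dom_eq_key_diagram[OF kd(2)])
  note h = hat_entry[OF fl]
  have inc': "?v c r \<le> ?v (Suc c) r" if "0 < ?v (Suc c) r" for c r using inc pos that by blast
  have "non_attacking (hat n T)"
    unfolding non_attacking_def
  proof (intro ballI impI)
    fix x y assume xy: "x \<in> dom (hat n T)" "y \<in> dom (hat n T)" "attack x y"
    obtain c r c' r' where x: "x = (c, r)" and y: "y = (c', r')" by (cases x, cases y)
    have px: "0 < ?v c r" "hat n T x = Some (?v c r)" using xy(1) h x by auto
    have py: "0 < ?v c' r'" "hat n T y = Some (?v c' r')" using xy(2) h y by auto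
    have ad: "?v (Suc c) r \<noteq> ?v c s" if "r < s" "0 < ?v (Suc c) r" "0 < ?v c s" for c r s
    proof
      assume e: "?v (Suc c) r = ?v c s"
      show False
      proof (cases "a s < a r")
        case True
        have "?v c r \<noteq> ?v c s" using inj[of c s r] that by auto
        then have "?v c r < ?v c s" using inc'[OF that(2)] e by simp
        then show False using tripA[OF that(1) True that(3)] e by simp
      next
        case False
        then have l: "?v (Suc c) s \<le> ?v (Suc c) r" using tripB[OF that(1), of c] that(2) e by simp
        have "Suc c \<le> a r" using pos that(2) by blast
        then have "?v c s \<le> ?v (Suc c) s" using inc[of c s] False by simp
        then have "?v (Suc c) r = ?v (Suc c) s" using l e by simp
        then show False using inj[of "Suc c" r s] that by simp
      qed
    qed
    have "?v c r \<noteq> ?v c' r'"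
      using xy(3) px(1) py(1) inj[of c r r'] ad[of r' r c] ad[of r r' c'] unfolding x y by auto
    then show "hat n T x \<noteq> hat n T y" using px py by simp
  qed
  moreover have "rows_increasing (hat n T)"
    unfolding rows_increasing_def using h inc' by auto
  moreover have "\<not> inversion_triple n T k i j" for k i j
  proof
    assume "inversion_triple n T k i j"
    then have t: "triple n T k i j" and o: "i > j \<and> j > k \<or> j > k \<and> k > i \<or> k > i \<and> i > j"
      unfolding inversion_triple_def by auto
    obtain c r s where rs: "r < s" and "a s < a r \<and> ?v c r = k \<and> ?v (Suc c) r = i \<and> ?v c s = j \<and> 0 < j \<and> 0 < i
      \<or> a r \<le> a s \<and> ?v (Suc c) r = j \<and> ?v c s = k \<and> ?v (Suc c) s = i \<and> 0 < j \<and> 0 < i"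
      using t unfolding triple_def sh h by auto
    then show False using o inc'[of c r] inc'[of c s] tripA[OF rs, of c] tripB[OF rs, of c] by auto
  qed
  ultimately show "T \<in> rSSAF n" using fl unfolding rSSAF_def by blast
qed

lemma FP_iff: "(S, T) \<in> FP n \<longleftrightarrow> (\<exists>a. key_filling_of n a S \<and> atom_filling_of n a T)"
proof
  assume "(S, T) \<in> FP n"
  then obtain a b where ab: "key_filling_of n a S" "atom_filling_of n b T" "sh S = sh T"
    unfolding FP_def using SSKT_iff rSSAF_iff by auto
  then have "sh S = a" "sh T = b"
    unfolding key_filling_of_def atom_filling_of_def by (simp_all add: sh_eq_if_dom_eq_key_diagram)
  then show "\<exists>a. key_filling_of n a S \<and> atom_filling_of n a T" using ab by auto
next
  assume "\<exists>a. key_filling_of n a S \<and> atom_filling_of n a T"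
  then obtain a where a: "key_filling_of n a S" "atom_filling_of n a T" by blast
  then have "sh S = a" "sh T = a"
    unfolding key_filling_of_def atom_filling_of_def by (simp_all add: sh_eq_if_dom_eq_key_diagram)
  then show "(S, T) \<in> FP n" using a SSKT_iff rSSAF_iff unfolding FP_def by auto
qed

text \<open>Only the basement depends on the size. A basement cell in front of an empty row can
  matter only as the upper cell of \<open>tripA\<close> in column \<open>0\<close>, where the order
  of the rows already gives the conclusion.\<close>

lemma key_filling_of_change:
  assumes kf: "key_filling_of i a S" and ar: "\<And>r. i' < r \<Longrightarrow> a r = 0"
  shows "key_filling_of i' a S"
proof -
  note kd = key_filling_ofD[OF kf]
  interpret key_filling i a "entry i S" by (rule kd(1))
  have eq: "entry i' S (Suc c) r = entry i S (Suc c) r" for c r by (simp add: entry_Suc)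
  have vz: "0 < entry i S 0 r \<longleftrightarrow> r \<in> {1..i}" for r by (simp add: entry_0)
  have supp': "a r = 0" if "r \<notin> {1..i'}" for r using ar[of r] supp[of r] that by (cases "i' < r") auto
  have both: "entry i S c r = entry i' S c r" if "0 < a r" for c r
  proof -
    have "r \<in> {1..i}" "r \<in> {1..i'}" using supp[of r] supp'[of r] that by auto
    then show ?thesis by (cases c) (auto simp: eq entry_0)
  qed
  have "key_filling i' a (entry i' S)"
  proof
    fix r assume "r \<notin> {1..i'}" then show "a r = 0" by (rule supp')
  next
    fix c r show "0 < entry i' S c r \<longleftrightarrow> r \<in> {1..i'} \<and> c \<le> a r"
    proof (cases c)
      case 0 then show ?thesis by (auto simp: entry_0)
    next
      case (Suc d)
      show ?thesis using pos[of "Suc d" r] supp[of r] supp'[of r] unfolding Suc eq by fastforce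
    qed
  next
    fix r assume "r \<in> {1..i'}" then show "entry i' S 0 r = r" by (simp add: entry_0)
  next
    fix c r show "entry i' S (Suc c) r \<le> entry i' S c r"
    proof (cases "0 < a r")
      case True then show ?thesis using dec both by metis
    next
      case False then show ?thesis using pos[of "Suc c" r] eq[of c r] by simp
    qed
  next
    fix c r s assume "entry i' S c r = entry i' S c s" "0 < entry i' S c r"
    then show "r = s" using inj[of c r s] by (cases c) (auto simp: eq entry_0 split: if_splits)
  next
    fix r s c assume rs: "r < s" "a s < a r" "0 < entry i' S c s" "entry i' S (Suc c) r \<le> entry i' S c s"
    show "entry i' S c r \<le> entry i' S c s"
    proof (cases c)
      case 0 then show ?thesis using rs by (auto simp: entry_0 split: if_splits)
    next
      case (Suc d) then show ?thesis using tripA[OF rs(1,2), of c] rs(3,4) by (simp add: eq)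
    qed
  next
    fix r s c assume rs: "r < s" "a r \<le> a s" "0 < entry i' S (Suc c) r" "entry i' S (Suc c) r \<le> entry i' S c s"
    have "Suc c \<le> a r" using pos[of "Suc c" r] rs(3) by (simp add: eq)
    then have "0 < a s" using rs(2) by simp
    then show "entry i' S (Suc c) r \<le> entry i' S (Suc c) s"
      using tripB[OF rs(1,2), of c] rs(3,4) both[of s c] by (simp add: eq[of c r] eq[of c s])
  qed
  then show ?thesis using kd(2) unfolding key_filling_of_def by blast
qed

text \<open>When the basement grows, a new cell in a row above \<open>i\<close> exceeds every entry
  of \<open>T\<close>, so \<open>tripA\<close> holds there. When it shrinks, the entries must still
  be bounded by the new size, hence \<open>le\<close>.\<close>

lemma atom_filling_of_change:
  assumes kf: "atom_filling_of i a T" and ar: "\<And>r. i' < r \<Longrightarrow> a r = 0"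
    and le: "\<And>c r x. T (c, r) = Some x \<Longrightarrow> x \<le> i'"
  shows "atom_filling_of i' a T"
proof -
  have kd: "atom_filling i a (entry i T)" "dom T = key_diagram a" using kf unfolding atom_filling_of_def by auto
  interpret atom_filling i a "entry i T" by (rule kd(1))
  have eq: "entry i' T (Suc c) r = entry i T (Suc c) r" for c r by (simp add: entry_Suc)
  have supp': "a r = 0" if "r \<notin> {1..i'}" for r using ar[of r] supp[of r] that by (cases "i' < r") auto
  have both: "entry i T c r = entry i' T c r" if "0 < a r" for c r
  proof -
    have "r \<in> {1..i}" "r \<in> {1..i'}" using supp[of r] supp'[of r] that by auto
    then show ?thesis by (cases c) (auto simp: eq entry_0)
  qed
  have le': "entry i' T c r \<le> i'" for c r using le by (cases c) (auto simp: entry_0 entry_Suc split: option.splits)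
  have "atom_filling i' a (entry i' T)"
  proof
    fix r assume "r \<notin> {1..i'}" then show "a r = 0" by (rule supp')
  next
    fix c r show "0 < entry i' T c r \<longleftrightarrow> r \<in> {1..i'} \<and> c \<le> a r"
    proof (cases c)
      case 0 then show ?thesis by (auto simp: entry_0)
    next
      case (Suc d)
      show ?thesis using pos[of "Suc d" r] supp[of r] supp'[of r] unfolding Suc eq by fastforce
    qed
  next
    fix r assume "r \<in> {1..i'}" then show "entry i' T 0 r = r" by (simp add: entry_0)
  next
    fix c r show "entry i' T c r \<le> i'" by (rule le')
  next
    fix c r assume "Suc c \<le> a r"
    then show "entry i' T c r \<le> entry i' T (Suc c) r" using inc[of c r] both[of r] by simp
  next
    fix c r s assume "entry i' T c r = entry i' T c s" "0 < entry i' T c r"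
    then show "r = s" using inj[of c r s] by (cases c) (auto simp: eq entry_0 split: if_splits)
  next
    fix r s c assume rs: "r < s" "a s < a r" "0 < entry i' T c s" "entry i' T c r < entry i' T c s"
    have r: "0 < a r" using rs(2) by simp
    show "entry i' T (Suc c) r < entry i' T c s"
    proof (cases c)
      case 0
      have s: "s \<in> {1..i'}" "entry i' T 0 s = s" using rs(3) 0 by (auto simp: entry_0 split: if_splits)
      show ?thesis
      proof (cases "s \<le> i")
        case True
        then have "entry i T 0 s = s" using s by (simp add: entry_0)
        then show ?thesis using tripA[OF rs(1,2), of 0] rs(3,4) s(2) both[OF r] unfolding 0 by simp
      next
        case False
        then show ?thesis using le_i[of "Suc 0" r] s(2) both[OF r, of "Suc 0"] unfolding 0 by simp
      qed
    next
      case (Suc d) then show ?thesis using tripA[OF rs(1,2), of c] rs(3,4) by (simp add: eq)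
    qed
  next
    fix r s c assume rs: "r < s" "a r \<le> a s" "0 < entry i' T (Suc c) r" "entry i' T c s \<le> entry i' T (Suc c) r"
    have "Suc c \<le> a r" using pos[of "Suc c" r] rs(3) by (simp add: eq)
    then have "0 < a s" using rs(2) by simp
    then show "entry i' T (Suc c) s \<le> entry i' T (Suc c) r"
      using tripB[OF rs(1,2), of c] rs(3,4) both[of s c] by (simp add: eq[of c r] eq[of c s])
  qed
  then show ?thesis using kd(2) unfolding atom_filling_of_def by blast
qed

section \<open>Words\<close>

lemma key_filling_of_mono:
  assumes "key_filling_of i a S" "i \<le> i'" shows "key_filling_of i' a S"
  using key_filling_of_change[OF assms(1)] key_filling.supp[OF key_filling_ofD(1)[OF assms(1)]] assms(2) by simp

lemma atom_filling_of_le: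
  assumes "atom_filling_of i a T" "T (c, r) = Some x" shows "x \<le> i" "1 \<le> x" "1 \<le> c"
proof -
  have A: "atom_filling i a (entry i T)" "dom T = key_diagram a" using assms(1) unfolding atom_filling_of_def by auto
  have "(c, r) \<in> key_diagram a" using A(2) assms(2) by blast
  then have c: "1 \<le> c" "c \<le> a r" by (auto simp: key_diagram_def)
  then obtain d where d: "c = Suc d" by (cases c) auto
  then have v: "entry i T c r = x" using assms(2) by (simp add: entry_Suc)
  have "r \<in> {1..i}" using c atom_filling.supp[OF A(1), of r] by fastforce
  then show "1 \<le> x" using atom_filling.pos[OF A(1), of c r] c v by auto
  show "x \<le> i" using atom_filling.le_i[OF A(1), of c r] v by simp
  show "1 \<le> c" by (rule c)
qed

lemma atom_filling_of_mono:
  assumes "atom_filling_of i a T" "i \<le> i'" shows "atom_filling_of i' a T"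
proof (rule atom_filling_of_change[OF assms(1)])
  have A: "atom_filling i a (entry i T)" using assms(1) unfolding atom_filling_of_def by auto
  show "a r = 0" if "i' < r" for r using atom_filling.supp[OF A, of r] that assms(2) by simp
  show "x \<le> i'" if "T (c, r) = Some x" for c r x using atom_filling_of_le(1)[OF assms(1) that] assms(2) by simp
qed

lemma pair_insert_eq:
  assumes "key_filling_of i a S" "key_filling_of i (a(r := Suc (a r))) (flagged_insert i S j)"
  shows "pair_insert (i, j) (S, T) = (flagged_insert i S j, T((Suc (a r), r) \<mapsto> i))"
proof -
  have "sh S = a" "sh (flagged_insert i S j) = a(r := Suc (a r))"
    by (rule sh_eq_if_dom_eq_key_diagram, rule key_filling_ofD(2), rule assms)+
  moreover have "key_diagram (a(r := Suc (a r))) - key_diagram a = {(Suc (a r), r)}"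
    by (auto simp: key_diagram_def split: if_splits)
  ultimately have "x \<in> key_diagram (sh (flagged_insert i S j)) - key_diagram (sh S) \<longleftrightarrow> x = (Suc (a r), r)" for x
    by (simp only:) blast
  then show ?thesis by (simp only: pair_insert_def Let_def fun_upd_def prod.case)
qed

text \<open>\<open>new\<close> speaks of all paths because the actual route is known only inside the
  proof. It places the new cell to the right of every recorded \<open>i\<close>, as
  \<open>add_max\<close> demands.\<close>

lemma pair_insert_step:
  assumes S: "key_filling_of i a S" and T: "atom_filling_of i a T" and j: "j \<in> {1..i}"
    and new: "\<And>N m k c r. \<lbrakk>bump_path N (cnt (entry i S)) j m k; column_counts N (cnt (entry i S)); T (c, r) = Some i\<rbrakk> \<Longrightarrow> c < k"
  obtains r m k N where "column_counts N (cnt (entry i S))" "bump_path N (cnt (entry i S)) j m k"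
    "pair_insert (i, j) (S, T) = (flagged_insert i S j, T((k, r) \<mapsto> i))" "T (k, r) = None"
    "key_filling_of i (a(r := k)) (flagged_insert i S j)" "atom_filling_of i (a(r := k)) (T((k, r) \<mapsto> i))"
    "\<And>d x. 0 < x \<Longrightarrow> cnt (entry i (flagged_insert i S j)) d x = shift (cnt (entry i S)) m d x"
    "\<And>c q. T (c, q) = Some i \<Longrightarrow> c < k"
    "\<And>l. wt (flagged_insert i S j) l = wt S l + (if l = j then 1 else 0)"
proof -
  obtain r m k N where "key_filling_of i (a(r := k)) (flagged_insert i S j) \<and>
    r \<in> {1..i} \<and> Suc (a r) = k \<and> (\<forall>q. r < q \<and> q \<le> i \<longrightarrow> a q \<noteq> a r) \<and>
    bump_path N (cnt (entry i S)) j m k \<and> (\<forall>d\<ge>N. \<forall>x>0. cnt (entry i S) d x = 0) \<and>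
    (\<forall>d x. 0 < x \<longrightarrow> cnt (entry i (flagged_insert i S j)) d x = shift (cnt (entry i S)) m d x) \<and>
    (\<forall>l. wt (flagged_insert i S j) l = wt S l + (if l = j then 1 else 0))"
    using flagged_insert_key_filling[OF S j] by (elim exE) (rule that)
  then have f: "key_filling_of i (a(r := k)) (flagged_insert i S j)" "r \<in> {1..i}" "Suc (a r) = k"
    "\<And>q. r < q \<Longrightarrow> q \<le> i \<Longrightarrow> a q \<noteq> a r" "bump_path N (cnt (entry i S)) j m k"
    "\<And>d x. N \<le> d \<Longrightarrow> 0 < x \<Longrightarrow> cnt (entry i S) d x = 0"
    "\<And>d x. 0 < x \<Longrightarrow> cnt (entry i (flagged_insert i S j)) d x = shift (cnt (entry i S)) m d x"
    "\<And>l. wt (flagged_insert i S j) l = wt S l + (if l = j then 1 else 0)"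
    by simp_all
  have cc: "column_counts N (cnt (entry i S))"
    by (rule key_filling.column_counts_cnt[OF key_filling_ofD(1)[OF S] f(6)])
  have lt: "c < k" if "T (c, q) = Some i" for c q using new[OF f(5) cc that] .
  have A: "atom_filling i a (entry i T)" "dom T = key_diagram a" using T unfolding atom_filling_of_def by auto
  have none: "T (k, r) = None" using key_diagram_dom(1)[OF A(2), of "a r" r] f(3) by simp
  have v: "entry i (T((Suc (a r), r) \<mapsto> i)) = put (entry i T) (Suc (a r)) r i" by (rule entry_upd)
  have "atom_filling i (a(r := k)) (entry i (T((k, r) \<mapsto> i)))"
    unfolding f(3)[symmetric] v
  proof (rule atom_filling.add_max[OF A(1) f(2) refl f(4)])
    fix d q assume d: "a r < d"
    then obtain e where e: "d = Suc e" by (cases d) auto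
    show "entry i T d q \<noteq> i"
    proof
      assume v: "entry i T d q = i"
      then have "T (d, q) = Some i" using j e by (auto simp: entry_Suc split: option.splits)
      then show False using lt[of d q] d f(3) by simp
    qed
  qed
  moreover have "dom (T((k, r) \<mapsto> i)) = key_diagram (a(r := k))"
    using A(2) f(3) by (auto simp: key_diagram_def)
  ultimately have T': "atom_filling_of i (a(r := k)) (T((k, r) \<mapsto> i))" unfolding atom_filling_of_def by blast
  have "pair_insert (i, j) (S, T) = (flagged_insert i S j, T((k, r) \<mapsto> i))"
    using pair_insert_eq[OF S, of r j T] f(1,3) by simp
  then show thesis by (rule that[OF cc f(5) _ none f(1) T' f(7) lt f(8)])
qed

section \<open>Sorted words and their successive insertion\<close>

definition letter_le :: "nat \<times> nat \<Rightarrow> nat \<times> nat \<Rightarrow> bool" where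
  "letter_le = (\<lambda>(i, j) (i', j'). i < i' \<or> i = i' \<and> j \<ge> j')"

definition flagged_words :: "nat \<Rightarrow> (nat \<times> nat) list set" where
  "flagged_words n = {w. sorted_wrt letter_le w \<and> (\<forall>(i, j)\<in>set w. 1 \<le> j \<and> j \<le> i \<and> i \<le> n)}"

definition run :: "(nat \<times> nat) list \<Rightarrow> filling \<times> filling" where
  "run w = fold pair_insert w (Map.empty, Map.empty)"

lemma run_Nil: "run [] = (Map.empty, Map.empty)"
  by (simp add: run_def)

lemma run_snoc: "run (w @ [x]) = pair_insert x (run w)"
  by (simp add: run_def)

lemma letter_le_trans: "letter_le x y \<Longrightarrow> letter_le y z \<Longrightarrow> letter_le x z"
  by (auto simp: letter_le_def split: prod.splits)

lemma flagged_words_snoc: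
  "w @ [(i, j)] \<in> flagged_words n \<longleftrightarrow> w \<in> flagged_words n \<and> 1 \<le> j \<and> j \<le> i \<and> i \<le> n \<and>
    (w \<noteq> [] \<longrightarrow> letter_le (last w) (i, j))"
proof -
  have "(\<forall>x\<in>set w. letter_le x (i, j)) \<longleftrightarrow> (w \<noteq> [] \<longrightarrow> letter_le (last w) (i, j))"
    if s: "sorted_wrt letter_le w"
  proof (cases w rule: rev_cases)
    case (snoc u y)
    then show ?thesis using s letter_le_trans[of _ y "(i, j)"] by (auto simp: sorted_wrt_append)
  qed simp
  then show ?thesis unfolding flagged_words_def by (auto simp: sorted_wrt_append)
qed

text \<open>The strip property is stated prospectively, for every route that a next letter with the
  same upper entry and a weakly smaller lower entry could take. It can thus be maintained before
  that letter is known.\<close>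

definition horizontal_strip :: "(nat \<times> nat) list \<Rightarrow> filling \<Rightarrow> filling \<Rightarrow> bool" where
  "horizontal_strip w S T \<longleftrightarrow> (\<forall>N m k j c r. w \<noteq> [] \<and> bump_path N (cnt (entry (fst (last w)) S)) j m k \<and>
     column_counts N (cnt (entry (fst (last w)) S)) \<and> j \<le> snd (last w) \<and> T (c, r) = Some (fst (last w)) \<longrightarrow> c < k)"

text \<open>Every basement size not below the upper entries is allowed, because the next letter may
  be inserted with a larger basement.\<close>

definition run_invariant :: "(nat \<times> nat) list \<Rightarrow> bool" where
  "run_invariant w \<longleftrightarrow> (\<forall>S T. run w = (S, T) \<longrightarrow>
     (\<forall>i. (\<forall>x\<in>set w. fst x \<le> i) \<longrightarrow> (\<exists>a. key_filling_of i a S \<and> atom_filling_of i a T)) \<and>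
     ran T = fst ` set w \<and> horizontal_strip w S T \<and>
     (\<forall>l. wt S l = count_list (map snd w) l \<and> wt T l = count_list (map fst w) l))"

lemma run_invariantD:
  assumes "run_invariant w" "run w = (S, T)"
  shows "(\<And>x. x \<in> set w \<Longrightarrow> fst x \<le> i) \<Longrightarrow> \<exists>a. key_filling_of i a S \<and> atom_filling_of i a T"
    and "ran T = fst ` set w" and "horizontal_strip w S T"
    and "wt S l = count_list (map snd w) l" and "wt T l = count_list (map fst w) l"
  using assms unfolding run_invariant_def by simp_all

lemma run_step:
  assumes w: "w @ [(i, j)] \<in> flagged_words n" and inv: "run_invariant w" and run: "run w = (S, T)"
  obtains a r m k N where "key_filling_of i a S" "atom_filling_of i a T"
    "column_counts N (cnt (entry i S))" "bump_path N (cnt (entry i S)) j m k"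
    "run (w @ [(i, j)]) = (flagged_insert i S j, T((k, r) \<mapsto> i))" "T (k, r) = None"
    "key_filling_of i (a(r := k)) (flagged_insert i S j)" "atom_filling_of i (a(r := k)) (T((k, r) \<mapsto> i))"
    "\<And>d x. 0 < x \<Longrightarrow> cnt (entry i (flagged_insert i S j)) d x = shift (cnt (entry i S)) m d x"
    "\<And>c q. T (c, q) = Some i \<Longrightarrow> c < k"
    "\<And>l. wt (flagged_insert i S j) l = wt S l + (if l = j then 1 else 0)"
proof -
  have le: "fst x \<le> i" if "x \<in> set w" for x
  proof -
    have "letter_le x (i, j)" using w that unfolding flagged_words_def by (simp add: sorted_wrt_append)
    then show ?thesis by (cases x) (auto simp: letter_le_def)
  qed
  obtain a where a: "key_filling_of i a S" "atom_filling_of i a T"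
    using run_invariantD(1)[OF inv run le] by blast
  have j: "j \<in> {1..i}" using w unfolding flagged_words_snoc by simp
  \<comment> \<open>If \<open>i\<close> is already recorded, then sortedness makes \<open>i\<close>
    the upper entry of the last letter of \<open>w\<close> as well, and the strip invariant
    applies.\<close>
  have new: "c < k" if p: "bump_path N (cnt (entry i S)) j m k" "column_counts N (cnt (entry i S))" "T (c, r) = Some i"
    for N m k c r
  proof -
    have "i \<in> fst ` set w" using run_invariantD(2)[OF inv run] ranI[of T "(c, r)" i] p(3) by simp
    then obtain x where x: "x \<in> set w" "fst x = i" by blast
    then have ne: "w \<noteq> []" by auto
    then have l: "letter_le (last w) (i, j)" using w unfolding flagged_words_snoc by simp
    have "x = last w \<or> letter_le x (last w)"
      using x(1) w ne by (cases w rule: rev_cases) (auto simp: flagged_words_def sorted_wrt_append)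
    then have "fst (last w) = i" "j \<le> snd (last w)" using l x(2) by (auto simp: letter_le_def split: prod.splits)
    then show ?thesis using run_invariantD(3)[OF inv run] p ne unfolding horizontal_strip_def by blast
  qed
  obtain r m k N where st: "column_counts N (cnt (entry i S))" "bump_path N (cnt (entry i S)) j m k"
    "pair_insert (i, j) (S, T) = (flagged_insert i S j, T((k, r) \<mapsto> i))" "T (k, r) = None"
    "key_filling_of i (a(r := k)) (flagged_insert i S j)" "atom_filling_of i (a(r := k)) (T((k, r) \<mapsto> i))"
    "\<And>d x. 0 < x \<Longrightarrow> cnt (entry i (flagged_insert i S j)) d x = shift (cnt (entry i S)) m d x"
    "\<And>c q. T (c, q) = Some i \<Longrightarrow> c < k"
    "\<And>l. wt (flagged_insert i S j) l = wt S l + (if l = j then 1 else 0)"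
    by (rule pair_insert_step[OF a j], rule new, assumption+) (rule that)
  have "run (w @ [(i, j)]) = (flagged_insert i S j, T((k, r) \<mapsto> i))" by (simp only: run_snoc run st(3))
  then show thesis by (rule that[OF a st(1,2) _ st(4-9)])
qed

lemma run_invariant:
  assumes "w \<in> flagged_words n"
  shows "run_invariant w"
  using assms
proof (induction w rule: rev_induct)
  case Nil
  have "key_filling_of i (\<lambda>_. 0) Map.empty" for i
    unfolding key_filling_of_def
  proof
    show "key_filling i (\<lambda>_. 0) (entry i Map.empty)"
      by unfold_locales (auto simp: entry_def hat_def split: if_splits)
  qed (auto simp: key_diagram_def)
  moreover have "atom_filling_of i (\<lambda>_. 0) Map.empty" for i
    unfolding atom_filling_of_def
  proof
    show "atom_filling i (\<lambda>_. 0) (entry i Map.empty)"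
      by unfold_locales (auto simp: entry_def hat_def split: if_splits)
  qed (auto simp: key_diagram_def)
  ultimately show ?case by (auto simp: run_invariant_def run_Nil horizontal_strip_def wt_def)
next
  case (snoc x w)
  obtain i j where x: "x = (i, j)" by (cases x)
  have ww: "w @ [(i, j)] \<in> flagged_words n" using snoc.prems x by simp
  have inv: "run_invariant w" using snoc.IH ww unfolding flagged_words_snoc by blast
  obtain S T where r: "run w = (S, T)" by (cases "run w")
  obtain a q m k N where st: "key_filling_of i a S" "atom_filling_of i a T"
    "column_counts N (cnt (entry i S))" "bump_path N (cnt (entry i S)) j m k"
    "run (w @ [(i, j)]) = (flagged_insert i S j, T((k, q) \<mapsto> i))" "T (k, q) = None"
    "key_filling_of i (a(q := k)) (flagged_insert i S j)" "atom_filling_of i (a(q := k)) (T((k, q) \<mapsto> i))"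
    "\<And>d x. 0 < x \<Longrightarrow> cnt (entry i (flagged_insert i S j)) d x = shift (cnt (entry i S)) m d x"
    "\<And>c q. T (c, q) = Some i \<Longrightarrow> c < k"
    "\<And>l. wt (flagged_insert i S j) l = wt S l + (if l = j then 1 else 0)"
    by (rule run_step[OF ww inv r]) (rule that)
  let ?S = "flagged_insert i S j" and ?T = "T((k, q) \<mapsto> i)"
  have "horizontal_strip (w @ [(i, j)]) ?S ?T"
    unfolding horizontal_strip_def
  proof (intro allI impI)
    fix N' m' k' j' c r
    assume h: "w @ [(i, j)] \<noteq> [] \<and> bump_path N' (cnt (entry (fst (last (w @ [(i, j)]))) ?S)) j' m' k' \<and>
       column_counts N' (cnt (entry (fst (last (w @ [(i, j)]))) ?S)) \<and>
       j' \<le> snd (last (w @ [(i, j)])) \<and> ?T (c, r) = Some (fst (last (w @ [(i, j)])))"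
    then have "k < k'" by (intro path_column_less[OF st(3) _ st(4) _ st(9)]) auto
    moreover have "c \<le> k" using h st(10)[of c r] by (auto split: if_splits)
    ultimately show "c < k'" by simp
  qed
  moreover have "ran ?T = fst ` set (w @ [(i, j)])"
    using run_invariantD(2)[OF inv r] st(6) by simp
  moreover have "wt ?S l = count_list (map snd (w @ [(i, j)])) l \<and> wt ?T l = count_list (map fst (w @ [(i, j)])) l" for l
  proof -
    have "finite (dom T)"
      using st(1,2) finite_dom_key_filling key_filling_ofD(2) unfolding atom_filling_of_def by metis
    from wt_add[OF this st(6), of i l]
    show ?thesis using run_invariantD(4,5)[OF inv r] st(11)[of l] by simp
  qed
  moreover have "\<exists>a. key_filling_of i' a ?S \<and> atom_filling_of i' a ?T" if "\<forall>x\<in>set (w @ [(i, j)]). fst x \<le> i'" for i'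
    using key_filling_of_mono[OF st(7)] atom_filling_of_mono[OF st(8)] that by auto
  ultimately show ?case unfolding run_invariant_def x st(5) by (simp del: fun_upd_apply)
qed

text \<open>A nonempty row \<open>r\<close> of the recording filling begins with an entry at least
  \<open>r\<close>, so a bound on the entries also bounds the nonempty rows.\<close>

lemma restrict_key_filling_of:
  assumes S: "key_filling_of n a S" and T: "atom_filling_of n a T"
    and le: "\<And>c r x. T (c, r) = Some x \<Longrightarrow> x \<le> i"
  shows "key_filling_of i a S" "atom_filling_of i a T"
proof -
  have A: "atom_filling n a (entry n T)" "dom T = key_diagram a" using T unfolding atom_filling_of_def by auto
  have "a r = 0" if "i < r" for r
  proof (rule ccontr)
    assume "a r \<noteq> 0"
    then have p: "Suc 0 \<le> a r" by simp
    then obtain x where x: "T (Suc 0, r) = Some x" using key_diagram_dom(1)[OF A(2), of 0 r] by (cases "T (Suc 0, r)") auto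
    have "r \<in> {1..n}" using atom_filling.supp[OF A(1), of r] p by fastforce
    then have "r \<le> x" using atom_filling.inc[OF A(1) p] atom_filling.base[OF A(1)] x by (simp add: entry_Suc)
    then show False using le[OF x] that by simp
  qed
  then show "key_filling_of i a S" "atom_filling_of i a T"
    using key_filling_of_change[OF S] atom_filling_of_change[OF T] le by blast+
qed

text \<open>The cell to remove is forced: the largest upper entry comes last, and new cells with
  equal upper entry move to the right, so it is the rightmost occurrence of the maximum.\<close>

lemma run_surj:
  assumes "key_filling_of n a S" "atom_filling_of n a T"
  shows "\<exists>w\<in>flagged_words n. run w = (S, T)"
  using assms
proof (induction "card (dom T)" arbitrary: a S T rule: less_induct)
  case (less T a S)
  have dT: "dom T = key_diagram a" and dS: "dom S = key_diagram a"
    using less.prems unfolding key_filling_of_def atom_filling_of_def by auto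
  have fin: "finite (dom T)" using finite_dom_key_filling[OF less.prems(1)] dT dS by simp
  show ?case
  proof (cases "dom T = {}")
    case True
    then have "T = Map.empty" "S = Map.empty" using dT dS by auto
    then show ?thesis by (intro bexI[of _ "[]"]) (auto simp: run_Nil flagged_words_def)
  next
    case False
    define i where "i = Max (ran T)"
    have finr: "finite (ran T)" using fin by (rule finite_ran)
    obtain x y where "T x = Some y" using False by blast
    then have "y \<in> ran T" by (rule ranI)
    then have "ran T \<noteq> {}" by blast
    then have "i \<in> ran T" unfolding i_def by (rule Max_in[OF finr])
    then have exi: "\<exists>c r. T (c, r) = Some i" by (auto simp: ran_def)
    have le: "x \<le> i" if "T (c, r) = Some x" for c r x
      unfolding i_def by (rule Max_ge[OF finr]) (use that in \<open>rule ranI\<close>)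
    have res: "key_filling_of i a S" "atom_filling_of i a T"
      by (rule restrict_key_filling_of[OF less.prems], rule le, assumption)+
    have Ti: "atom_filling i a (entry i T)" using res(2) unfolding atom_filling_of_def by simp
    have i1: "1 \<le> i" "i \<le> n" using exi atom_filling_of_le[OF less.prems(2)] by auto
    let ?C = "{c. \<exists>r. T (c, r) = Some i}"
    have finC: "finite ?C" by (rule finite_subset[OF _ finite_imageI[OF fin, of fst]]) force
    have "Max ?C \<in> ?C" by (rule Max_in[OF finC]) (use exi in auto)
    then obtain r where r: "T (Max ?C, r) = Some i" by blast
    have "1 \<le> Max ?C" using atom_filling_of_le(3)[OF less.prems(2) r] .
    then obtain c where c: "Max ?C = Suc c" by (cases "Max ?C") auto
    have Tr: "T (Suc c, r) = Some i" using r c by simp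
    have last: "entry i T d q \<noteq> i" if cd: "Suc c < d" for d q
    proof
      assume v: "entry i T d q = i"
      obtain e where e: "d = Suc e" using cd by (cases d) auto
      have "T (d, q) = Some i" using v i1 e by (auto simp: entry_Suc split: option.splits)
      then have "d \<le> Max ?C" by (intro Max_ge[OF finC]) auto
      then show False using c cd by simp
    qed
    have wi: "entry i T (Suc c) r = i" using Tr by (simp add: entry_Suc)
    have i0: "0 < i" using i1 by simp
    note remove = atom_filling.remove_max[OF Ti wi i0]
    have rm1: "a r = Suc c" by (rule remove(1)) (rule last)
    have rm2: "a q \<noteq> c" if "r < q" "q \<le> i" for q by (rule remove(2)[OF _ that]) (rule last)
    have rm3: "atom_filling i (a(r := c)) (put (entry i T) (Suc c) r 0)" by (rule remove(3)) (rule last)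
    have rm4: "put (entry i T) (Suc c) r 0 d q \<noteq> i" if "c < d" for d q by (rule remove(4)[OF _ that]) (rule last)
    let ?T = "T((Suc c, r) := None)"
    have aT: "atom_filling_of i (a(r := c)) ?T"
      unfolding atom_filling_of_def entry_del using rm3 dT rm1 by (auto simp: key_diagram_def)
    obtain S' j where S': "key_filling_of i (a(r := c)) S'" "j \<in> {1..i}" "flagged_insert i S' j = S"
      using flagged_insert_preimage[OF res(1) rm1] rm2 by blast
    have "dom ?T = dom T - {(Suc c, r)}" by auto
    moreover have "(Suc c, r) \<in> dom T" using Tr by blast
    ultimately have "card (dom ?T) < card (dom T)" using fin by (simp only: card_Diff1_less)
    from less.hyps[OF this key_filling_of_mono[OF S'(1) i1(2)] atom_filling_of_mono[OF aT i1(2)]]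
    obtain w where w: "w \<in> flagged_words n" "run w = (S', ?T)" by blast
    have ins: "pair_insert (i, j) (S', ?T) = (S, T)"
      using pair_insert_eq[OF S'(1), of r j ?T] S'(3) res(1) rm1 Tr by (auto simp: fun_upd_idem)
    have "letter_le (last w) (i, j)" if ne: "w \<noteq> []"
    proof -
      obtain u i' j' where u: "w = u @ [(i', j')]" using ne by (cases w rule: rev_cases) auto
      have inv: "run_invariant w" by (rule run_invariant[OF w(1)])
      have "i' \<in> ran ?T" using run_invariantD(2)[OF inv w(2)] u by simp
      then have "i' \<le> i" using le by (auto simp: ran_def split: if_splits)
      \<comment> \<open>Otherwise \<open>path_column_le\<close> would place the cell of the larger
        letter \<open>j\<close> weakly to the left of the cell of \<open>j'\<close>. But the former
        is in column \<open>c + 1\<close>, and all other entries \<open>i\<close> are in columns up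
        to \<open>c\<close>.\<close>
      moreover have "j \<le> j'" if ii: "i' = i"
      proof (rule ccontr)
        assume "\<not> j \<le> j'"
        then have jj: "j' < j" by simp
        have uw: "u @ [(i, j')] \<in> flagged_words n" using w(1) u ii by simp
        then have "u \<in> flagged_words n" unfolding flagged_words_snoc by blast
        then have iu: "run_invariant u" by (rule run_invariant)
        obtain S2 T2 where ru: "run u = (S2, T2)" by (cases "run u")
        obtain b q m k N where st: "key_filling_of i b S2" "atom_filling_of i b T2"
          "column_counts N (cnt (entry i S2))" "bump_path N (cnt (entry i S2)) j' m k"
          "run (u @ [(i, j')]) = (flagged_insert i S2 j', T2((k, q) \<mapsto> i))" "T2 (k, q) = None"
          "key_filling_of i (b(q := k)) (flagged_insert i S2 j')" "atom_filling_of i (b(q := k)) (T2((k, q) \<mapsto> i))"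
          "\<And>d x. 0 < x \<Longrightarrow> cnt (entry i (flagged_insert i S2 j')) d x = shift (cnt (entry i S2)) m d x"
          "\<And>c q. T2 (c, q) = Some i \<Longrightarrow> c < k"
          "\<And>l. wt (flagged_insert i S2 j') l = wt S2 l + (if l = j' then 1 else 0)"
          by (rule run_step[OF uw iu ru]) (rule that)
        have e: "S' = flagged_insert i S2 j'" "?T = T2((k, q) \<mapsto> i)" using w(2) u ii st(5) by auto
        have "?T (k, q) = Some i" using e(2) by simp
        then have "entry i ?T k q = i" "1 \<le> k"
          using atom_filling_of_le(3)[OF aT] by (auto simp: entry_def hat_def)
        then have kc: "k \<le> c" using rm4[of k q] unfolding entry_del by (meson not_le)
        obtain r' m' k' N' where f: "key_filling_of i ((a(r := c))(r' := k')) S" "Suc ((a(r := c)) r') = k'"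
          "bump_path N' (cnt (entry i S')) j m' k'"
          using flagged_insert_key_filling[OF S'(1,2)] S'(3) by blast
        \<comment> \<open>Comparing shapes identifies the end of the forward route with the removed
          cell.\<close>
        have sa: "(a(r := c))(r' := k') = a"
          using sh_eq_if_dom_eq_key_diagram[OF key_filling_ofD(2)[OF f(1)]] sh_eq_if_dom_eq_key_diagram[OF dS] by simp
        have "r' = r"
        proof (rule ccontr)
          assume "r' \<noteq> r"
          then show False using fun_cong[OF sa, of r] rm1 by simp
        qed
        then have "k' = Suc c" using f(2) by simp
        moreover have "k' \<le> k"
          by (rule path_column_le[OF st(3,4) f(3)[unfolded e(1)] st(9) jj])
        ultimately show False using kc by simp
      qed
      ultimately show ?thesis using u by (auto simp: letter_le_def)
    qed
    then have "w @ [(i, j)] \<in> flagged_words n" unfolding flagged_words_snoc using w(1) S'(2) i1 by auto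
    then show ?thesis using ins w(2) run_snoc[of w "(i, j)"] by auto
  qed
qed

lemma run_snoc_max:
  assumes w: "w @ [(i, j)] \<in> flagged_words n" and r: "run (w @ [(i, j)]) = (S, T)"
  shows "ran T = insert i (fst ` set w)" and "\<And>x. x \<in> ran T \<Longrightarrow> x \<le> i"
proof -
  show R: "ran T = insert i (fst ` set w)"
    using run_invariantD(2)[OF run_invariant[OF w] r] by simp
  have "letter_le y (i, j)" if "y \<in> set w" for y
    using w that unfolding flagged_words_def by (simp add: sorted_wrt_append)
  then have "fst y \<le> i" if "y \<in> set w" for y using that by (fastforce simp: letter_le_def)
  then show "x \<le> i" if "x \<in> ran T" for x using that unfolding R by auto
qed

text \<open>The hypothesis compares counts instead of key tableaux because
  \<open>path_unique\<close> returns only counts of the smaller tableaux, so this is what the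
  induction can pass on. Positive columns suffice and have the same counts for every basement
  size.\<close>

lemma run_inj:
  assumes "w \<in> flagged_words n" "w' \<in> flagged_words n" "run w = (S, T)" "run w' = (S', T)"
    and "\<And>d x. 0 < x \<Longrightarrow> cnt (entry n S) (Suc d) x = cnt (entry n S') (Suc d) x"
  shows "w = w'"
  using assms
proof (induction w arbitrary: w' S S' T rule: rev_induct)
  case Nil
  have "T = Map.empty" using Nil(3) by (auto simp: run_Nil)
  then have "ran T = {}" by simp
  moreover have "ran T = fst ` set w'" by (rule run_invariantD(2)[OF run_invariant[OF Nil(2)] Nil(4)])
  ultimately show ?case by simp
next
  case (snoc x w)
  obtain i j where x: "x = (i, j)" by (cases x)
  have ww: "w @ [(i, j)] \<in> flagged_words n" using snoc.prems(1) x by simp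
  have r1: "run (w @ [(i, j)]) = (S, T)" using snoc.prems(3) x by simp
  note max1 = run_snoc_max[OF ww r1]
  have "ran T = fst ` set w'"
    by (rule run_invariantD(2)[OF run_invariant[OF snoc.prems(2)] snoc.prems(4)])
  then have "w' \<noteq> []" using max1(1) by auto
  then obtain u y where "w' = u @ [y]" by (cases w' rule: rev_cases) auto
  moreover obtain i' j' where "y = (i', j')" by (cases y)
  ultimately have w': "w' = u @ [(i', j')]" by simp
  have uu: "u @ [(i', j')] \<in> flagged_words n" using snoc.prems(2) w' by simp
  have r2: "run (u @ [(i', j')]) = (S', T)" using snoc.prems(4) w' by simp
  note max2 = run_snoc_max[OF uu r2]
  have "i \<in> ran T" using max1(1) by simp
  then have l1: "i \<le> i'" by (rule max2(2))
  have "i' \<in> ran T" using max2(1) by simp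
  then have "i' \<le> i" by (rule max1(2))
  then have ii: "i' = i" using l1 by simp
  have w0: "w \<in> flagged_words n" "u \<in> flagged_words n" using ww uu unfolding flagged_words_snoc by auto
  obtain S1 T1 where s1: "run w = (S1, T1)" by (cases "run w")
  obtain S2 T2 where s2: "run u = (S2, T2)" by (cases "run u")
  obtain a q m k N where st: "key_filling_of i a S1" "atom_filling_of i a T1"
    "column_counts N (cnt (entry i S1))" "bump_path N (cnt (entry i S1)) j m k"
    "run (w @ [(i, j)]) = (flagged_insert i S1 j, T1((k, q) \<mapsto> i))" "T1 (k, q) = None"
    "key_filling_of i (a(q := k)) (flagged_insert i S1 j)" "atom_filling_of i (a(q := k)) (T1((k, q) \<mapsto> i))"
    "\<And>d x. 0 < x \<Longrightarrow> cnt (entry i (flagged_insert i S1 j)) d x = shift (cnt (entry i S1)) m d x"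
    "\<And>c q. T1 (c, q) = Some i \<Longrightarrow> c < k"
    "\<And>l. wt (flagged_insert i S1 j) l = wt S1 l + (if l = j then 1 else 0)"
    by (rule run_step[OF ww run_invariant[OF w0(1)] s1]) (rule that)
  have uu': "u @ [(i, j')] \<in> flagged_words n" using uu ii by simp
  obtain b p m' k' N' where st': "key_filling_of i b S2" "atom_filling_of i b T2"
    "column_counts N' (cnt (entry i S2))" "bump_path N' (cnt (entry i S2)) j' m' k'"
    "run (u @ [(i, j')]) = (flagged_insert i S2 j', T2((k', p) \<mapsto> i))" "T2 (k', p) = None"
    "key_filling_of i (b(p := k')) (flagged_insert i S2 j')" "atom_filling_of i (b(p := k')) (T2((k', p) \<mapsto> i))"
    "\<And>d x. 0 < x \<Longrightarrow> cnt (entry i (flagged_insert i S2 j')) d x = shift (cnt (entry i S2)) m' d x"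
    "\<And>c q. T2 (c, q) = Some i \<Longrightarrow> c < k'"
    "\<And>l. wt (flagged_insert i S2 j') l = wt S2 l + (if l = j' then 1 else 0)"
    by (rule run_step[OF uu' run_invariant[OF w0(2)] s2]) (rule that)
  have eq: "S = flagged_insert i S1 j" "S' = flagged_insert i S2 j'"
    "T = T1((k, q) \<mapsto> i)" "T = T2((k', p) \<mapsto> i)"
    using r1 r2 st(5) st'(5) ii by auto
  have Tk: "T (k, q) = Some i" unfolding eq(3) by simp
  have Tk': "T (k', p) = Some i" unfolding eq(4) by simp
  \<comment> \<open>In either word the last cell is strictly to the right of all other cells
    recorded with \<open>i\<close>; applied both ways, this makes the two cells equal.\<close>
  have A: "(k', p) = (k, q) \<or> k' < k"
    using Tk' st(10)[of k' p] unfolding eq(3) by (auto split: if_splits)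
  have B: "(k, q) = (k', p) \<or> k < k'"
    using Tk st'(10)[of k q] unfolding eq(4) by (auto split: if_splits)
  have kk: "k' = k" "p = q" using A B by auto
  have "T1 = T((k, q) := None)" using eq(3) st(6) by (auto simp: fun_upd_idem)
  moreover have "T2 = T((k, q) := None)" using eq(4) st'(6) kk by (auto simp: fun_upd_idem)
  ultimately have TT: "T2 = T1" by simp
  have vn: "entry n X (Suc d) = entry i X (Suc d)" for X d by (simp add: fun_eq_iff entry_Suc)
  have cn: "cnt (entry n X) (Suc d) = cnt (entry i X) (Suc d)" for X d by (simp add: fun_eq_iff cnt_def vn)
  have sheq: "shift (cnt (entry i S1)) m d x = shift (cnt (entry i S2)) m' d x" if "1 \<le> d" "0 < x" for d x
  proof -
    obtain e where "d = Suc e" using \<open>1 \<le> d\<close> by (cases d) auto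
    then show ?thesis
      using snoc.prems(5)[OF that(2), of e] st(9)[OF that(2), of d] st'(9)[OF that(2), of d]
      unfolding cn eq(1,2) by simp
  qed
  note pu = path_unique[OF st(3) st'(3) st(4) st'(4)[unfolded kk(1)] sheq]
  have "cnt (entry n S1) (Suc d) x = cnt (entry n S2) (Suc d) x" if "0 < x" for d x
    unfolding cn by (rule pu(3)) (use that in auto)
  then have "w = u" by (intro snoc.IH[OF w0 s1 s2[unfolded TT]])
  then show ?case using pu(2) x w' ii by simp
qed

section \<open>Sorted words and matrices\<close>

lemma sorted_letters_unique:
  assumes "sorted_wrt letter_le xs" "sorted_wrt letter_le ys" "\<And>z. count_list xs z = count_list ys z"
  shows "xs = ys"
  using assms
proof (induction xs arbitrary: ys)
  case Nil
  have "y \<notin> set ys" for y using Nil(3)[of y] by (simp add: count_list_0_iff[symmetric])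
  then show ?case by (cases ys) auto
next
  case (Cons x xs)
  have "count_list ys x \<noteq> 0" using Cons.prems(3)[of x] by simp
  then have xy: "x \<in> set ys" by (metis count_list_0_iff)
  then obtain y ys' where ys: "ys = y # ys'" by (cases ys) auto
  have "count_list (x # xs) y \<noteq> 0" using Cons.prems(3)[of y] ys by simp
  then have yx: "y \<in> set (x # xs)" by (metis count_list_0_iff)
  have "x = y"
  proof (rule ccontr)
    assume "x \<noteq> y"
    then have "letter_le x y" "letter_le y x" using xy yx ys Cons.prems(1,2) by auto
    then show False using \<open>x \<noteq> y\<close> by (auto simp: letter_le_def split: prod.splits)
  qed
  moreover have "count_list xs z = count_list ys' z" for z
    using Cons.prems(3)[of z] ys \<open>x = y\<close> by (simp split: if_splits)
  then have "xs = ys'" using Cons.IH[of ys'] Cons.prems(1,2) ys by simp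
  ultimately show ?case using ys by simp
qed

lemma biword_in_flagged_words:
  assumes "L \<in> lower_triangular n" shows "biword n L \<in> flagged_words n"
proof -
  have "1 \<le> j \<and> j \<le> i \<and> i \<le> n" if "(i, j) \<in> set (biword n L)" for i j
  proof -
    have "L i j \<noteq> 0" using that count_list_biword[OF assms, of i j] count_list_0_iff by metis
    then show ?thesis using assms unfolding lower_triangular_def by blast
  qed
  then show ?thesis using sorted_wrt_biword[of n L] unfolding flagged_words_def letter_le_def by auto
qed

lemma count_list_flagged_word:
  assumes "w \<in> flagged_words n"
  shows "(\<lambda>i j. count_list w (i, j)) \<in> lower_triangular n" and "biword n (\<lambda>i j. count_list w (i, j)) = w"
proof -
  show L: "(\<lambda>i j. count_list w (i, j)) \<in> lower_triangular n"
    unfolding lower_triangular_def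
  proof (intro CollectI allI impI)
    fix i j assume "count_list w (i, j) \<noteq> 0"
    then have "(i, j) \<in> set w" by (metis count_list_0_iff)
    then show "1 \<le> j \<and> j \<le> i \<and> i \<le> n" using assms unfolding flagged_words_def by blast
  qed
  show "biword n (\<lambda>i j. count_list w (i, j)) = w"
  proof (rule sorted_letters_unique)
    show "sorted_wrt letter_le (biword n (\<lambda>i j. count_list w (i, j)))"
      using biword_in_flagged_words[OF L] unfolding flagged_words_def by simp
    show "sorted_wrt letter_le w" using assms unfolding flagged_words_def by simp
    show "count_list (biword n (\<lambda>i j. count_list w (i, j))) z = count_list w z" for z
      using count_list_biword[OF L] by (cases z) simp
  qed
qed

lemma count_list_map_snd:
  fixes w :: "(nat \<times> nat) list"
  shows "\<forall>x\<in>set w. fst x \<in> {1..n} \<Longrightarrow> count_list (map snd w) j = (\<Sum>i\<in>{1..n}. count_list w (i, j))"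
proof (induction w)
  case (Cons x w)
  obtain p q where x: "x = (p, q)" by (cases x)
  have "(\<Sum>i\<in>{1..n}. count_list (x # w) (i, j)) =
      (\<Sum>i\<in>{1..n}. count_list w (i, j)) + (\<Sum>i\<in>{1..n}. if i = p then (if q = j then 1 else 0) else 0)"
    unfolding sum.distrib[symmetric] by (intro sum.cong) (auto simp: x)
  also have "(\<Sum>i\<in>{1..n}. if i = p then (if q = j then 1 else 0) else 0) = (if q = j then 1 else 0 :: nat)"
    by (subst sum.delta) (use Cons.prems x in auto)
  finally show ?case using Cons x by simp
qed simp

lemma count_list_map_fst:
  fixes w :: "(nat \<times> nat) list"
  shows "\<forall>x\<in>set w. snd x \<in> {1..n} \<Longrightarrow> count_list (map fst w) i = (\<Sum>j\<in>{1..n}. count_list w (i, j))"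
proof (induction w)
  case (Cons x w)
  obtain p q where x: "x = (p, q)" by (cases x)
  have "(\<Sum>j\<in>{1..n}. count_list (x # w) (i, j)) =
      (\<Sum>j\<in>{1..n}. count_list w (i, j)) + (\<Sum>j\<in>{1..n}. if j = q then (if p = i then 1 else 0) else 0)"
    unfolding sum.distrib[symmetric] by (intro sum.cong) (auto simp: x)
  also have "(\<Sum>j\<in>{1..n}. if j = q then (if p = i then 1 else 0) else 0) = (if p = i then 1 else 0 :: nat)"
    by (subst sum.delta) (use Cons.prems x in auto)
  finally show ?case using Cons x by simp
qed simp

lemma bij_betw_run: "bij_betw run (flagged_words n) (FP n)"
  unfolding bij_betw_def
proof
  show "inj_on run (flagged_words n)"
  proof (rule inj_onI)
    fix w w' assume w: "w \<in> flagged_words n" "w' \<in> flagged_words n" "run w = run w'"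
    obtain S T where r: "run w = (S, T)" by (cases "run w")
    show "w = w'" by (rule run_inj[OF w(1,2) r r[unfolded w(3)] refl])
  qed
  show "run ` flagged_words n = FP n"
  proof (intro equalityI subsetI)
    fix x assume "x \<in> run ` flagged_words n"
    then obtain w where w: "w \<in> flagged_words n" "x = run w" by blast
    obtain S T where x: "x = (S, T)" by (cases x)
    have "\<forall>y\<in>set w. fst y \<le> n" using w(1) unfolding flagged_words_def by auto
    then show "x \<in> FP n"
      using run_invariantD(1)[OF run_invariant[OF w(1)], of S T n] w(2) unfolding x FP_iff by simp
  next
    fix x assume "x \<in> FP n"
    moreover obtain S T where x: "x = (S, T)" by (cases x)
    ultimately obtain a where "key_filling_of n a S" "atom_filling_of n a T" using FP_iff by blast
    then obtain w where "w \<in> flagged_words n" "run w = (S, T)" using run_surj by blast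
    then show "x \<in> run ` flagged_words n" unfolding x by (metis imageI)
  qed
qed

lemma bij_betw_biword: "bij_betw (biword n) (lower_triangular n) (flagged_words n)"
proof (rule bij_betw_byWitness[where f' = "\<lambda>w i j. count_list w (i, j)"])
  show "\<forall>L\<in>lower_triangular n. (\<lambda>i j. count_list (biword n L) (i, j)) = L"
    by (intro ballI ext) (rule count_list_biword)
  show "\<forall>w\<in>flagged_words n. biword n (\<lambda>i j. count_list w (i, j)) = w"
    by (intro ballI count_list_flagged_word(2))
  show "biword n ` lower_triangular n \<subseteq> flagged_words n"
    by (intro image_subsetI biword_in_flagged_words)
  show "(\<lambda>w i j. count_list w (i, j)) ` flagged_words n \<subseteq> lower_triangular n"
    by (rule image_subsetI) (erule count_list_flagged_word(1))
qed

theorem theorem5p11: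
  fixes n :: nat
  assumes "n \<ge> 1"
  shows "bij_betw (fRSK n) (lower_triangular n) (FP n) \<and>
    (\<forall>L\<in>lower_triangular n. \<forall>S T. fRSK n L = (S, T) \<longrightarrow> col n L = wt S \<and> row n L = wt T)"
proof (intro conjI ballI allI impI)
  have eq: "fRSK n = run \<circ> biword n" by (simp add: fun_eq_iff fRSK_def run_def)
  show "bij_betw (fRSK n) (lower_triangular n) (FP n)"
    unfolding eq by (rule bij_betw_trans[OF bij_betw_biword bij_betw_run])
  fix L S T assume L: "L \<in> lower_triangular n" and r: "fRSK n L = (S, T)"
  have W: "biword n L \<in> flagged_words n" by (rule biword_in_flagged_words[OF L])
  then have in1: "\<forall>x\<in>set (biword n L). fst x \<in> {1..n}" and in2: "\<forall>x\<in>set (biword n L). snd x \<in> {1..n}"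
    unfolding flagged_words_def by force+
  have wt: "wt S l = count_list (map snd (biword n L)) l" "wt T l = count_list (map fst (biword n L)) l" for l
    using run_invariantD(4,5)[OF run_invariant[OF W]] r unfolding eq by simp_all
  show "col n L = wt S"
    by (simp add: fun_eq_iff wt count_list_map_snd[OF in1] col_def count_list_biword[OF L])
  show "row n L = wt T"
    by (simp add: fun_eq_iff wt count_list_map_fst[OF in2] row_def count_list_biword[OF L])
qed

end
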